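(* Let $(G,\rho)$ be a unimodular random rooted graph on which the continuous-time edge-driven random walk is almost surely non-explosive. Then for every $t\ge 0$, $$\mathbb{E}\big[|\zeta_t^\rho|^2\big]\le 1+2t\,\mathbf{E}[\deg(\rho)].$$
   Context: **Random rooted graphs.** A rooted graph is a pair $(G,\rho)$ with $G=(V,E)$ a graph and $\rho\in V$. Let $\mathcal{G}_\bullet$ be the set of isomorphism classes (isomorphisms must map root to root) of locally finite, connected, undirected rooted graphs with no loops or multiple edges, and $\mathcal{G}_{\bullet\bullet}$ the analogous set of isomorphism classes of bi-rooted graphs $(G,x,y)$, both equipped with the local topology and its Borel $\sigma$-algebra. A random rooted graph is a random variable $(G,\rho)$ with values in $\mathcal{G}_\bullet$; $\mathbf{P},\mathbf{E}$ denote its probability and expectation. It is *unimodular* if for every Borel function $F:\mathcal{G}_{\bullet\bullet}\to[0,\infty)$, $$\mathbf{E}\Big[\sum_{x\in V}F(G,\rho,x)\Big]=\mathbf{E}\Big[\sum_{x\in V}F(G,x,\rho)\Big].$$ **Edge-driven walk.** The continuous-time edge-driven random walk jumps along each edge adjacent to its present location at rate 1. It is non-explosive if it almost surely makes at most finitely many jumps in any finite time interval. (It is known that this holds almost surely on every unimodular random rooted graph with $\mathbf{E}[\deg(\rho)]<\infty$.) **Coalescing random walk and voter model.** Let $F=\{(v,w):\{v,w\}\in E\}$ be the set of directed edges and $\{U_{(v,w)}:(v,w)\in F\}$ independent unit-intensity Poisson point processes on $[0,\infty)$. For $v\in V$, $s\ge0$, let $\Theta_t(v,s)$, $t\ge s$,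 be the path with $\Theta_s(v,s)=v$ which jumps from $w$ to $u$ at time $t$ whenever $\Theta_{t^-}(v,s)=w$ and $t\in U_{(w,u)}$. Coalescing random walk is $\xi_t^v=\Theta_t(v,0)$, the position at time $t$ of the particle started at $v$. The voter model initialized at time $T>0$ is, for $t\in[0,T]$, $\zeta_t^v=\{w\in V:\Theta_T(w,T-t)=v\}$; it is the set of vertices which at voter-model time $t$ hold the opinion that started at $v$ (each vertex starts with its own distinct opinion, and for each $(v,w)\in F$, at rate 1, $v$ adopts the current opinion of $w$). The law of $\zeta_t^v$ does not depend on $T\ge t$; taking $T=t$, $\zeta_t^v=\{w\in V:\xi_t^w=v\}$. $\mathbb{P},\mathbb{E}$ denote annealed probability and expectation, i.e. with respect to the joint law of $(G,\rho)$ and the process on it. Convention: $0\cdot\infty=0$. *)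

theory Defs
  imports "HOL-Probability.Probability"
begin

section \<open>Rooted graphs and the local topology\<close>

text \<open>
  A graph with a list of roots is a triple of vertex set, set of directed edges (both orientations
  of every undirected edge), and roots. One root gives rooted graphs, two roots give bi-rooted
  graphs. Connected locally finite graphs are countable, so vertices in \<^typ>\<open>nat\<close> suffice to
  obtain all isomorphism classes.
\<close>

type_synonym rgraph = "nat set \<times> (nat \<times> nat) set \<times> nat list"

definition rooted_graph :: "nat \<Rightarrow> rgraph \<Rightarrow> bool" where
  "rooted_graph k = (\<lambda>(V, E, rs).
     E \<subseteq> V \<times> V \<and> sym E \<and> irrefl E \<and>
     (\<forall>v\<in>V. finite (E `` {v})) \<and>
     (\<forall>u\<in>V. \<forall>v\<in>V. (u, v) \<in> E\<^sup>*) \<and>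
     set rs \<subseteq> V \<and> length rs = k)"

definition rooted_iso :: "rgraph \<Rightarrow> rgraph \<Rightarrow> bool" where
  "rooted_iso = (\<lambda>(V, E, rs) (V', E', rs').
     \<exists>f. bij_betw f V V' \<and>
         (\<forall>x\<in>V. \<forall>y\<in>V. (x, y) \<in> E \<longleftrightarrow> (f x, f y) \<in> E') \<and>
         map f rs = rs')"

definition iso_class :: "rgraph \<Rightarrow> rgraph set" where
  "iso_class G = {H. rooted_graph (length (snd (snd H))) H \<and> rooted_iso G H}"

definition iso_classes :: "nat \<Rightarrow> rgraph set set" where
  "iso_classes k = iso_class ` {G. rooted_graph k G}"

text \<open>
  The subgraph induced by the vertices at graph distance at most \<open>r\<close> from the roots. For two roots
  this is the union of two balls; since the roots are at finite distance, this gives the same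
  topology as comparing large balls around the first root with the second root marked.
\<close>

definition root_ball :: "nat \<Rightarrow> rgraph \<Rightarrow> rgraph" where
  "root_ball r = (\<lambda>(V, E, rs).
     let B = {v\<in>V. \<exists>x\<in>set rs. \<exists>i\<le>r. (x, v) \<in> E ^^ i} in (B, E \<inter> B \<times> B, rs))"

definition local_topology :: "nat \<Rightarrow> rgraph set topology" where
  "local_topology k = topology_generated_by
     {{c \<in> iso_classes k. \<exists>H\<in>c. rooted_iso (root_ball r G) (root_ball r H)} | r G. rooted_graph k G}"

definition graph_space :: "nat \<Rightarrow> rgraph set measure" where
  "graph_space k = sigma (iso_classes k) {A. openin (local_topology k) A}"

section \<open>Random rooted graphs and unimodularity\<close>

text \<open>
  The random variable with values in isomorphism classes is \<open>\<omega> \<mapsto> iso_class (V \<omega>, E \<omega>, [\<rho> \<omega>])\<close>;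
  the triple itself is an arbitrary choice of representatives, on which no further measurability
  is imposed.
\<close>

definition random_rooted_graph ::
  "'a measure \<Rightarrow> ('a \<Rightarrow> nat set) \<Rightarrow> ('a \<Rightarrow> (nat \<times> nat) set) \<Rightarrow> ('a \<Rightarrow> nat) \<Rightarrow> bool" where
  "random_rooted_graph M V E \<rho> \<longleftrightarrow>
     prob_space M \<and>
     (\<forall>\<omega>\<in>space M. rooted_graph 1 (V \<omega>, E \<omega>, [\<rho> \<omega>])) \<and>
     (\<lambda>\<omega>. iso_class (V \<omega>, E \<omega>, [\<rho> \<omega>])) \<in> M \<rightarrow>\<^sub>M graph_space 1"

definition unimodular ::
  "'a measure \<Rightarrow> ('a \<Rightarrow> nat set) \<Rightarrow> ('a \<Rightarrow> (nat \<times> nat) set) \<Rightarrow> ('a \<Rightarrow> nat) \<Rightarrow> bool" where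
  "unimodular M V E \<rho> \<longleftrightarrow>
     (\<forall>F :: rgraph set \<Rightarrow> real.
        F \<in> borel_measurable (graph_space 2) \<and> (\<forall>c\<in>space (graph_space 2). 0 \<le> F c) \<longrightarrow>
        (\<integral>\<^sup>+\<omega>. (\<integral>\<^sup>+x. ennreal (F (iso_class (V \<omega>, E \<omega>, [\<rho> \<omega>, x]))) \<partial>count_space (V \<omega>)) \<partial>M) =
        (\<integral>\<^sup>+\<omega>. (\<integral>\<^sup>+x. ennreal (F (iso_class (V \<omega>, E \<omega>, [x, \<rho> \<omega>]))) \<partial>count_space (V \<omega>)) \<partial>M))"

section \<open>Poisson point processes\<close>

definition locally_finite_sets :: "real set set" where
  "locally_finite_sets = {S. S \<subseteq> {0..} \<and> (\<forall>b. finite (S \<inter> {0..b}))}"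

definition configuration_space :: "real set measure" where
  "configuration_space = sigma locally_finite_sets
     {{S \<in> locally_finite_sets. card (S \<inter> A) = n} | A n. A \<in> sets borel \<and> bounded A}"

definition unit_poisson_process :: "'w measure \<Rightarrow> ('w \<Rightarrow> real set) \<Rightarrow> bool" where
  "unit_poisson_process N X \<longleftrightarrow>
     X \<in> N \<rightarrow>\<^sub>M configuration_space \<and>
     (\<forall>A n. A \<in> sets borel \<and> bounded A \<and> A \<subseteq> {0..} \<longrightarrow>
        measure N {w \<in> space N. card (X w \<inter> A) = n} =
          exp (- measure lborel A) * measure lborel A ^ n / fact n) \<and>
     (\<forall>A :: nat \<Rightarrow> real set.
        (\<forall>i. A i \<in> sets borel \<and> bounded (A i) \<and> A i \<subseteq> {0..}) \<and> disjoint_family A \<longrightarrow>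
        prob_space.indep_vars N (\<lambda>_. count_space UNIV) (\<lambda>i w. card (X w \<inter> A i)) UNIV)"

definition poisson_clocks ::
  "(nat \<times> nat) set \<Rightarrow> 'w measure \<Rightarrow> (nat \<times> nat \<Rightarrow> 'w \<Rightarrow> real set) \<Rightarrow> bool" where
  "poisson_clocks E N U \<longleftrightarrow>
     prob_space N \<and>
     (\<forall>e\<in>E. unit_poisson_process N (U e)) \<and>
     prob_space.indep_vars N (\<lambda>_. configuration_space) U E"

section \<open>Walks driven by the clocks, and the voter model\<close>

text \<open>
  The first jump after time \<open>r\<close> of a particle at \<open>w\<close>: its new position and the jump time, or
  \<^term>\<open>None\<close> if there is none. The infimum is attained for locally finite clocks and finite degree;
  the target is unique unless two clocks ring simultaneously, an event of probability zero.
\<close>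

definition next_jump ::
  "(nat \<times> nat) set \<Rightarrow> (nat \<times> nat \<Rightarrow> real set) \<Rightarrow> nat \<times> real \<Rightarrow> (nat \<times> real) option" where
  "next_jump E U = (\<lambda>(w, r).
     let R = {t. r < t \<and> (\<exists>u. (w, u) \<in> E \<and> t \<in> U (w, u))} in
     if R = {} then None
     else Some (SOME u. (w, u) \<in> E \<and> Inf R \<in> U (w, u), Inf R))"

text \<open>Position after the \<open>n\<close>-th jump and time of that jump, for the particle started at \<open>v\<close> at time \<open>s\<close>.\<close>

primrec jumps ::
  "(nat \<times> nat) set \<Rightarrow> (nat \<times> nat \<Rightarrow> real set) \<Rightarrow> nat \<Rightarrow> real \<Rightarrow> nat \<Rightarrow> (nat \<times> real) option" where
  "jumps E U v s 0 = Some (v, s)"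
| "jumps E U v s (Suc n) = Option.bind (jumps E U v s n) (next_jump E U)"

text \<open>
  \<open>Theta_at E U v s t x\<close> says \<open>\<Theta>\<^sub>t(v, s) = x\<close>. It holds for no \<open>x\<close> if infinitely many jumps
  occur by time \<open>t\<close>.
\<close>

definition Theta_at ::
  "(nat \<times> nat) set \<Rightarrow> (nat \<times> nat \<Rightarrow> real set) \<Rightarrow> nat \<Rightarrow> real \<Rightarrow> real \<Rightarrow> nat \<Rightarrow> bool" where
  "Theta_at E U v s t x \<longleftrightarrow>
     (\<exists>n r. jumps E U v s n = Some (x, r) \<and> r \<le> t \<and>
            (\<forall>y r'. jumps E U v s (Suc n) = Some (y, r') \<longrightarrow> t < r'))"

text \<open>The path started at \<open>v\<close> at time 0 is an edge-driven walk: it crosses each edge at rate 1.\<close>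

definition nonexplosive :: "(nat \<times> nat) set \<Rightarrow> (nat \<times> nat \<Rightarrow> real set) \<Rightarrow> nat \<Rightarrow> bool" where
  "nonexplosive E U v \<longleftrightarrow>
     (\<forall>b. finite {n. \<exists>x r. jumps E U v 0 n = Some (x, r) \<and> r \<le> b})"

definition voter ::
  "nat set \<Rightarrow> (nat \<times> nat) set \<Rightarrow> (nat \<times> nat \<Rightarrow> real set) \<Rightarrow> real \<Rightarrow> real \<Rightarrow> nat \<Rightarrow> nat set" where
  "voter V E U T t v = {w\<in>V. Theta_at E U w (T - t) T v}"

section \<open>Annealed law\<close>

text \<open>
  \<open>N \<omega>\<close> is the conditional law of the clocks given the graph chosen by \<open>\<omega>\<close>. The annealed
  probability averages the quenched one over \<open>\<omega>\<close>; the quenched law of the walks and of the voter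
  model depends only on the graph, so no measurability of \<open>N\<close> in \<open>\<omega>\<close> is required.
\<close>

definition annealed_expectation ::
  "'a measure \<Rightarrow> ('a \<Rightarrow> 'w measure) \<Rightarrow> ('a \<Rightarrow> 'w \<Rightarrow> ennreal) \<Rightarrow> ennreal" where
  "annealed_expectation M N Z = (\<integral>\<^sup>+\<omega>. (\<integral>\<^sup>+w. Z \<omega> w \<partial>N \<omega>) \<partial>M)"

end

theory Submission
  imports Defs
begin

text \<open>
  Write \<open>|\<zeta>|\<^sup>2\<close> as the number of pairs of walks that end at the root. By mass transport its expectation
  is the expected number of walks that end where the walk from the root ends. Two walks are
  independent until they meet, and an edge between them makes them meet at rate 2; as the walk is
  symmetric, the starting points of the second walk sum to at most 1, and the number of merged walks
  grows at rate at most twice the expected degree at the position of the first walk, which is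
  at most \<open>\<^bold>E deg \<rho>\<close>, again by mass transport.

  All of this is carried out for time steps of length \<open>h = t / n\<close>. A pair of walks is killed as soon
  as two relevant clocks ring in the same step, and a walk moves only if the clocks at its target
  are silent in that step, which makes its kernel symmetric. The bound then holds exactly for every
  \<open>n\<close>, the transition probabilities are functions of finite balls and hence measurable on rooted
  graphs, and almost surely the discrete pair agrees with the continuous one for all large \<open>n\<close>,
  so that Fatou's lemma gives the claim.
\<close>

section \<open>Local functions of rooted graphs\<close>

text \<open>The obstacle is measurability: only the isomorphism class of the rooted graph is a
  random variable, while representatives and conditional clock laws may depend on
  \<open>\<omega>\<close> in any way. The functions handed to mass transport and to Fatou's lemma
  over the graph must be functions of the class. Continuous-time transition probabilities see the
  whole graph; those of finitely many steps see a ball of fixed radius and are locally constant.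

  The bound is exact for every \<open>n\<close> because the chain only loses mass. A move from
  \<open>x\<close> to \<open>u\<close> has weight \<open>h * exp (- h * d)\<close>, where
  \<open>d\<close> counts the clocks at \<open>x\<close> and \<open>u\<close>: the clock of
  \<open>(x, u)\<close> rings once and the others are silent. Rows sum to at most
  \<open>(1 + h * deg x) * exp (- h * deg x) \<le> 1\<close>, and by symmetry so do columns. The
  loss is harmless, as Fatou's lemma only needs the chain to catch each good pair for large
  \<open>n\<close>.

  In the bound, 1 stands for the pair of the root's walk with itself. The constant
  \<open>2 * t\<close> collects \<open>n\<close> steps with \<open>2 * h\<close> each, since either
  walk may cross the edge that separates it from the other.\<close>

definition nball :: "(nat \<times> nat) set \<Rightarrow> nat \<Rightarrow> nat set \<Rightarrow> nat set" where
  "nball E r S = {v. \<exists>x\<in>S. \<exists>i\<le>r. (x, v) \<in> E ^^ i}"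

definition partial_iso ::
  "(nat \<Rightarrow> nat) \<Rightarrow> nat set \<Rightarrow> (nat \<times> nat) set \<Rightarrow> nat set \<Rightarrow> (nat \<times> nat) set \<Rightarrow> bool" where
  "partial_iso f A E A' E' \<longleftrightarrow>
     bij_betw f A A' \<and> (\<forall>x\<in>A. \<forall>y\<in>A. (x, y) \<in> E \<longleftrightarrow> (f x, f y) \<in> E')"

lemma nball_mono: "r \<le> s \<Longrightarrow> S \<subseteq> T \<Longrightarrow> nball E r S \<subseteq> nball E s T"
  unfolding nball_def by (blast intro: order_trans)

lemma nballI: "x \<in> S \<Longrightarrow> i \<le> r \<Longrightarrow> (x, v) \<in> E ^^ i \<Longrightarrow> v \<in> nball E r S"
  unfolding nball_def by blast

lemma subset_nball: "S \<subseteq> nball E r S"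
  by (auto intro: nballI[of _ _ 0])

lemma nball_0 [simp]: "nball E 0 S = S"
  unfolding nball_def by auto

lemma nball_nball: "nball E r (nball E m S) \<subseteq> nball E (r + m) S"
proof
  fix v assume "v \<in> nball E r (nball E m S)"
  then obtain x y i j where "x \<in> S" "i \<le> m" "(x, y) \<in> E ^^ i" "j \<le> r" "(y, v) \<in> E ^^ j"
    unfolding nball_def by blast
  then have "(x, v) \<in> E ^^ (i + j)" "i + j \<le> r + m" by (auto simp: relpow_add)
  with \<open>x \<in> S\<close> show "v \<in> nball E (r + m) S" unfolding nball_def by blast
qed

lemma nball_subset: "E \<subseteq> V \<times> V \<Longrightarrow> S \<subseteq> V \<Longrightarrow> nball E r S \<subseteq> V"
proof -
  assume *: "E \<subseteq> V \<times> V" "S \<subseteq> V"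
  have "x \<in> V \<Longrightarrow> (x, v) \<in> E ^^ i \<Longrightarrow> v \<in> V" for x v i
    using *(1) by (induction i arbitrary: v) auto
  then show ?thesis using *(2) unfolding nball_def by blast
qed

lemma finite_nball:
  assumes "\<And>v. finite (E `` {v})" "finite S"
  shows "finite (nball E r S)"
proof -
  have "finite {v. (x, v) \<in> E ^^ i}" for x i
  proof (induction i)
    case (Suc i)
    have "{v. (x, v) \<in> E ^^ Suc i} = (\<Union>y\<in>{v. (x, v) \<in> E ^^ i}. E `` {y})" by auto
    with Suc assms(1) show ?case by simp
  qed simp
  moreover have "nball E r S = (\<Union>x\<in>S. \<Union>i\<in>{..r}. {v. (x, v) \<in> E ^^ i})"
    unfolding nball_def by auto
  ultimately show ?thesis using assms(2) by simp
qed

lemma partial_iso_inv: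
  "partial_iso f A E A' E' \<Longrightarrow> partial_iso (inv_into A f) A' E' A E"
  unfolding partial_iso_def bij_betw_def
  by (auto simp: inv_into_into f_inv_into_f inj_on_inv_into)

text \<open>All vertices on a path of length at most \<open>r\<close> from \<open>S\<close> lie in
  the ball, so \<open>f\<close> preserves its edges one by one.\<close>

lemma partial_iso_relpow:
  assumes "partial_iso f A E A' E'" "S \<subseteq> A" "nball E r S \<subseteq> A"
    and "x \<in> S" "i \<le> r" "(x, v) \<in> E ^^ i"
  shows "(f x, f v) \<in> E' ^^ i"
  using assms(5,6)
proof (induction i arbitrary: v)
  case (Suc i)
  then obtain y where y: "(x, y) \<in> E ^^ i" "(y, v) \<in> E" by auto
  have "y \<in> nball E r S" "v \<in> nball E r S"
    using nballI[OF assms(4) _ y(1)] nballI[OF assms(4) Suc.prems] Suc.prems(1) by auto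
  then have "y \<in> A" "v \<in> A" using assms(3) by auto
  with assms(1) y(2) have "(f y, f v) \<in> E'" unfolding partial_iso_def by blast
  with Suc.IH[OF _ y(1)] Suc.prems show ?case by auto
qed simp

text \<open>Paths are carried forward by \<open>f\<close> and back by its inverse, which is why both
  balls have to lie inside the domains.\<close>

lemma partial_iso_nball:
  assumes iso: "partial_iso f A E A' E'" and S: "S \<subseteq> A"
    and B: "nball E r S \<subseteq> A" and B': "nball E' r (f ` S) \<subseteq> A'"
  shows "f ` nball E r S = nball E' r (f ` S)"
    and "partial_iso f (nball E r S) E (nball E' r (f ` S)) E'"
proof -
  have inj: "inj_on f A" and im: "f ` A = A'"
    using iso unfolding partial_iso_def bij_betw_def by auto
  show *: "f ` nball E r S = nball E' r (f ` S)"
  proof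
    show "f ` nball E r S \<subseteq> nball E' r (f ` S)"
      unfolding nball_def using partial_iso_relpow[OF iso S B] by blast
  next
    show "nball E' r (f ` S) \<subseteq> f ` nball E r S"
    proof
      fix v assume v: "v \<in> nball E' r (f ` S)"
      then obtain x i where x: "x \<in> S" "i \<le> r" "(f x, v) \<in> E' ^^ i" unfolding nball_def by auto
      have "(inv_into A f (f x), inv_into A f v) \<in> E ^^ i"
        by (rule partial_iso_relpow[OF partial_iso_inv[OF iso] _ B' _ x(2,3)]) (use S im x in auto)
      moreover have "inv_into A f (f x) = x" using inj S x(1) by (auto intro: inv_into_f_f)
      ultimately have "inv_into A f v \<in> nball E r S" unfolding nball_def using x by auto
      moreover have "f (inv_into A f v) = v" using v B' im by (intro f_inv_into_f) auto
      ultimately show "v \<in> f ` nball E r S" by (metis imageI)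
    qed
  qed
  show "partial_iso f (nball E r S) E (nball E' r (f ` S)) E'"
    unfolding partial_iso_def bij_betw_def *[symmetric]
    using B iso inj_on_subset[OF inj B] unfolding partial_iso_def by blast
qed

definition ball_iso ::
  "nat \<Rightarrow> (nat \<times> nat) set \<Rightarrow> nat list \<Rightarrow> (nat \<times> nat) set \<Rightarrow> nat list \<Rightarrow> (nat \<Rightarrow> nat) \<Rightarrow> bool" where
  "ball_iso r E rs E' rs' f \<longleftrightarrow>
     partial_iso f (nball E r (set rs)) E (nball E' r (set rs')) E' \<and> map f rs = rs'"

text \<open>A ball of radius \<open>r\<close> around vertices at distance at most \<open>m\<close>
  from the roots lies in the ball of radius \<open>r + m\<close>. Hence vertices of the ball can be
  added as roots and carried along by the same map; every closure property of
  \<open>local_fun\<close> under summation rests on this.\<close>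

lemma ball_iso_restrict:
  assumes iso: "ball_iso R E rs E' rs' f" and ss: "set ss \<subseteq> nball E m (set rs)" and "r + m \<le> R"
  shows "ball_iso r E ss E' (map f ss) f" "set (map f ss) \<subseteq> nball E' m (set rs')"
proof -
  let ?A = "nball E R (set rs)" and ?A' = "nball E' R (set rs')"
  have p: "partial_iso f ?A E ?A' E'" and rs': "set rs' = f ` set rs"
    using iso unfolding ball_iso_def by auto
  have im: "f ` nball E m (set rs) = nball E' m (set rs')"
    using partial_iso_nball(1)[OF p subset_nball, of m] assms(3)
    by (simp add: rs' nball_mono)
  then show *: "set (map f ss) \<subseteq> nball E' m (set rs')" using ss by auto
  have "nball E r (set ss) \<subseteq> ?A"
    using nball_mono[OF order_refl ss] nball_nball nball_mono[OF assms(3) order_refl] by blast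
  moreover have "nball E' r (f ` set ss) \<subseteq> ?A'"
    using nball_mono[OF order_refl *] nball_nball nball_mono[OF assms(3) order_refl]
    by (metis list.set_map subset_trans)
  moreover have "set ss \<subseteq> ?A" using ss assms(3) nball_mono[of m R] by fastforce
  ultimately show "ball_iso r E ss E' (map f ss) f"
    unfolding ball_iso_def using partial_iso_nball(2)[OF p] by simp
qed

text \<open>Translates the sets that generate the local topology into \<open>ball_iso\<close>, which
  does not mention the vertex set.\<close>

lemma root_ball_iso_iff:
  assumes "rooted_graph k (V, E, rs)" "rooted_graph k (V', E', rs')"
  shows "rooted_iso (root_ball r (V, E, rs)) (root_ball r (V', E', rs')) \<longleftrightarrow>
    (\<exists>f. ball_iso r E rs E' rs' f)"
proof -
  have "{v\<in>V. \<exists>x\<in>set rs. \<exists>i\<le>r. (x, v) \<in> E ^^ i} = nball E r (set rs)"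
    using nball_subset[of E V "set rs" r] assms(1) unfolding rooted_graph_def nball_def by auto
  moreover have "{v\<in>V'. \<exists>x\<in>set rs'. \<exists>i\<le>r. (x, v) \<in> E' ^^ i} = nball E' r (set rs')"
    using nball_subset[of E' V' "set rs'" r] assms(2) unfolding rooted_graph_def nball_def by auto
  ultimately show ?thesis
    unfolding rooted_iso_def root_ball_def Let_def ball_iso_def partial_iso_def prod.case
    by (intro ex_cong1) (auto dest: bij_betwE)
qed

lemma rooted_iso_ball_iso:
  assumes "rooted_graph k (V, E, rs)" "rooted_graph k (V', E', rs')"
    and "rooted_iso (V, E, rs) (V', E', rs')"
  shows "\<exists>f. ball_iso r E rs E' rs' f"
proof -
  obtain f where f: "partial_iso f V E V' E'" "map f rs = rs'"
    using assms(3) unfolding rooted_iso_def partial_iso_def by auto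
  have s: "set rs' = f ` set rs" using f(2) by auto
  have "partial_iso f (nball E r (set rs)) E (nball E' r (f ` set rs)) E'"
    using assms(1,2) s
    by (intro partial_iso_nball(2)[OF f(1)] nball_subset) (auto simp: rooted_graph_def)
  then show ?thesis using f(2) s unfolding ball_iso_def by auto
qed

text \<open>The radius is uniform over all graphs. No graph axioms are imposed on \<open>E\<close>,
  so the closure properties below carry no side conditions on the graph.\<close>

definition local_fun :: "nat \<Rightarrow> ((nat \<times> nat) set \<Rightarrow> nat list \<Rightarrow> 'b) \<Rightarrow> bool" where
  "local_fun k f \<longleftrightarrow> (\<exists>r. \<forall>E rs E' rs' \<phi>. length rs = k \<longrightarrow> 
     ball_iso r E rs E' rs' \<phi> \<longrightarrow> f E rs = f E' rs')"

lemma local_funI: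
  assumes "\<And>E rs E' rs' \<phi>. length rs = k \<Longrightarrow> length rs' = k \<Longrightarrow> 
      ball_iso r E rs E' rs' \<phi> \<Longrightarrow> rs' = map \<phi> rs \<Longrightarrow> f E rs = f E' rs'"
  shows "local_fun k f"
  unfolding local_fun_def
proof (intro exI[of _ r] allI impI)
  fix E rs E' rs' \<phi>
  assume *: "length rs = k" "ball_iso r E rs E' rs' \<phi>"
  have "rs' = map \<phi> rs" using *(2) by (simp add: ball_iso_def)
  with * show "f E rs = f E' rs'" by (intro assms) auto
qed

lemma ball_iso_mono: "ball_iso R E rs E' rs' f \<Longrightarrow> r \<le> R \<Longrightarrow> ball_iso r E rs E' rs' f"
  using ball_iso_restrict(1)[of R E rs E' rs' f rs 0 r] by (auto simp: ball_iso_def)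

lemma ball_iso_inj: "ball_iso r E rs E' rs' f \<Longrightarrow> inj_on f (nball E r (set rs))"
  by (simp add: ball_iso_def partial_iso_def bij_betw_def)

lemma ball_iso_edge:
  "ball_iso r E rs E' rs' f \<Longrightarrow> x \<in> nball E r (set rs) \<Longrightarrow> y \<in> nball E r (set rs) \<Longrightarrow>
   (x, y) \<in> E \<longleftrightarrow> (f x, f y) \<in> E'"
  by (simp add: ball_iso_def partial_iso_def)

lemma local_fun_const: "local_fun k (\<lambda>E rs. c)"
  by (rule local_funI) simp

lemma local_fun_comp2:
  assumes "local_fun k f" "local_fun k g"
  shows "local_fun k (\<lambda>E rs. F (f E rs) (g E rs))"
proof -
  obtain r s where *:
    "\<forall>E rs E' rs' \<phi>. length rs = k \<longrightarrow> 
       ball_iso r E rs E' rs' \<phi> \<longrightarrow> f E rs = f E' rs'"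
    "\<forall>E rs E' rs' \<phi>. length rs = k \<longrightarrow> 
       ball_iso s E rs E' rs' \<phi> \<longrightarrow> g E rs = g E' rs'"
    using assms unfolding local_fun_def by auto
  show ?thesis
  proof (rule local_funI[where r = "max r s"])
    fix E rs E' rs' \<phi>
    assume **: "length rs = k" "ball_iso (max r s) E rs E' rs' \<phi>"
    have "ball_iso r E rs E' rs' \<phi>" "ball_iso s E rs E' rs' \<phi>"
      using ball_iso_mono[OF **(2)] by simp_all
    with * ** have "f E rs = f E' rs'" "g E rs = g E' rs'" by blast+
    then show "F (f E rs) (g E rs) = F (f E' rs') (g E' rs')" by simp
  qed
qed

lemma local_fun_comp:
  assumes "local_fun k f"
  shows "local_fun k (\<lambda>E rs. F (f E rs))"
  by (rule local_fun_comp2[where F = "\<lambda>x _. F x" and f = f and g = f, OF assms assms])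

lemma local_fun_if:
  assumes "local_fun k b" "local_fun k f" "local_fun k g"
  shows "local_fun k (\<lambda>E rs. if b E rs then f E rs else g E rs)"
proof -
  have "local_fun k (\<lambda>E rs. (b E rs, f E rs))"
    using local_fun_comp2[where F = Pair and f = b and g = f] assms(1,2) .
  from local_fun_comp2[where F = "\<lambda>p z. if fst p then snd p else z" and g = g, OF this assms(3)]
  show ?thesis unfolding fst_conv snd_conv .
qed

lemma local_fun_cong:
  assumes "\<And>E rs. length rs = k \<Longrightarrow> f E rs = g E rs"
  shows "local_fun k f \<longleftrightarrow> local_fun k g"
proof -
  have "length rs = k \<Longrightarrow> ball_iso r E rs E' rs' \<phi> \<Longrightarrow> length rs' = k" for E rs E' rs' r \<phi>
    by (auto simp: ball_iso_def)
  then have *: "(length rs = k \<longrightarrow> ball_iso r E rs E' rs' \<phi> \<longrightarrow> f E rs = f E' rs') \<longleftrightarrow>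
      (length rs = k \<longrightarrow> ball_iso r E rs E' rs' \<phi> \<longrightarrow> g E rs = g E' rs')" for E rs E' rs' r \<phi>
    using assms[of rs E] assms[of rs' E'] by auto
  show ?thesis unfolding local_fun_def * ..
qed

lemma local_fun_eq:
  assumes "i < k" "j < k"
  shows "local_fun k (\<lambda>E rs. rs ! i = rs ! j)"
proof (rule local_funI[where r = 0])
  fix E rs E' rs' \<phi>
  assume *: "length rs = k" "ball_iso 0 E rs E' rs' \<phi>" "rs' = map \<phi> rs"
  show "(rs ! i = rs ! j) = (rs' ! i = rs' ! j)"
    using ball_iso_inj[OF *(2)] * assms by (auto simp: inj_on_eq_iff)
qed

lemma local_fun_adj:
  assumes "i < k" "j < k"
  shows "local_fun k (\<lambda>E rs. (rs ! i, rs ! j) \<in> E)"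
proof (rule local_funI[where r = 0])
  fix E rs E' rs' \<phi>
  assume *: "length rs = k" "ball_iso 0 E rs E' rs' \<phi>" "rs' = map \<phi> rs"
  show "((rs ! i, rs ! j) \<in> E) = ((rs' ! i, rs' ! j) \<in> E')"
    using ball_iso_edge[OF *(2)] * assms by auto
qed

lemma local_fun_reindex:
  assumes "local_fun (length ns) f" "\<forall>i\<in>set ns. i < k"
  shows "local_fun k (\<lambda>E rs. f E (map (\<lambda>i. rs ! i) ns))"
proof -
  obtain r where r: "\<forall>E rs E' rs' \<phi>. length rs = length ns \<longrightarrow> 
       ball_iso r E rs E' rs' \<phi> \<longrightarrow> f E rs = f E' rs'"
    using assms unfolding local_fun_def by auto
  show ?thesis
  proof (rule local_funI)
    fix E rs E' rs' \<phi>
    assume *: "length rs = k" "ball_iso r E rs E' rs' \<phi>" "rs' = map \<phi> rs"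
    have m: "map (\<lambda>i. rs' ! i) ns = map \<phi> (map (\<lambda>i. rs ! i) ns)" using * assms(2) by simp
    have "set (map (\<lambda>i. rs ! i) ns) \<subseteq> nball E 0 (set rs)" using *(1) assms(2) by auto
    then have "ball_iso r E (map (\<lambda>i. rs ! i) ns) E' (map \<phi> (map (\<lambda>i. rs ! i) ns)) \<phi>"
      by (rule ball_iso_restrict(1)[OF *(2)]) simp
    then show "f E (map (\<lambda>i. rs ! i) ns) = f E' (map (\<lambda>i. rs' ! i) ns)"
      unfolding m by (intro r[rule_format]) (use *(1) in auto)
  qed
qed

text \<open>The summation variable becomes an additional root, at the price of enlarging the radius
  by \<open>m\<close>; the ball isomorphism matches the two ranges of summation.\<close>

lemma local_fun_sum_nball:
  fixes f :: "_ \<Rightarrow> _ \<Rightarrow> 'b :: comm_monoid_add"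
  assumes "local_fun (Suc k) f" "i < k"
  shows "local_fun k (\<lambda>E rs. \<Sum>u\<in>nball E m {rs ! i}. f E (rs @ [u]))"
proof -
  obtain r where r: "\<forall>E rs E' rs' \<phi>. length rs = Suc k \<longrightarrow> 
       ball_iso r E rs E' rs' \<phi> \<longrightarrow> f E rs = f E' rs'"
    using assms unfolding local_fun_def by auto
  show ?thesis
  proof (rule local_funI[where r = "r + m"])
    fix E rs E' rs' \<phi>
    assume *: "length rs = k" "ball_iso (r + m) E rs E' rs' \<phi>" "rs' = map \<phi> rs"
    have "ball_iso m E [rs ! i] E' [\<phi> (rs ! i)] \<phi>"
      using ball_iso_restrict(1)[OF *(2), of "[rs ! i]" 0 m] *(1) assms(2) by auto
    then have bij: "bij_betw \<phi> (nball E m {rs ! i}) (nball E' m {rs' ! i})"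
      using * assms(2) by (simp add: ball_iso_def partial_iso_def)
    have "f E (rs @ [u]) = f E' (rs' @ [\<phi> u])" if "u \<in> nball E m {rs ! i}" for u
    proof -
      have "u \<in> nball E m (set rs)"
        using that *(1) assms(2) nball_mono[OF order_refl, of "{rs ! i}" "set rs" E m] by auto
      then have "set (rs @ [u]) \<subseteq> nball E m (set rs)" using subset_nball by simp
      then have "ball_iso r E (rs @ [u]) E' (map \<phi> (rs @ [u])) \<phi>"
        by (rule ball_iso_restrict(1)[OF *(2)]) simp
      then have "ball_iso r E (rs @ [u]) E' (rs' @ [\<phi> u]) \<phi>" using *(3) by simp
      then show ?thesis by (intro r[rule_format]) (use *(1) in auto)
    qed
    then show "(\<Sum>u\<in>nball E m {rs ! i}. f E (rs @ [u])) = (\<Sum>u\<in>nball E' m {rs' ! i}. f E' (rs' @ [u]))"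
      by (subst sum.reindex_bij_betw[OF bij, symmetric]) simp
  qed
qed

text \<open>The neighbours form a locally definable part of the unit ball, so the sum is a ball sum
  with the adjacency indicator inside.\<close>

lemma local_fun_sum_nbrs:
  fixes f :: "_ \<Rightarrow> _ \<Rightarrow> 'b :: comm_monoid_add"
  assumes "local_fun (Suc k) f" "i < k"
  shows "local_fun k (\<lambda>E rs. \<Sum>u\<in>E `` {rs ! i}. f E (rs @ [u]))"
proof -
  have "local_fun (Suc k) (\<lambda>E rs. if (rs ! i, rs ! k) \<in> E then f E rs else 0)"
    using assms by (intro local_fun_if local_fun_adj local_fun_const) auto
  from local_fun_sum_nball[OF this assms(2), of 1]
  have "local_fun k (\<lambda>E rs. \<Sum>u\<in>nball E 1 {rs ! i}. if ((rs @ [u]) ! i, (rs @ [u]) ! k) \<in> E then f E (rs @ [u]) else 0)" .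
  moreover have "(\<Sum>u\<in>nball E 1 {rs ! i}. if ((rs @ [u]) ! i, (rs @ [u]) ! k) \<in> E then f E (rs @ [u]) else 0)
      = (\<Sum>u\<in>E `` {rs ! i}. f E (rs @ [u]))" if "length rs = k" for E rs
  proof -
    have n: "nball E 1 {rs ! i} = insert (rs ! i) (E `` {rs ! i})"
      by (auto simp: nball_def le_Suc_eq)
    show ?thesis
    proof (cases "finite (E `` {rs ! i})")
      case True
      have "E `` {rs ! i} = {u \<in> nball E 1 {rs ! i}. (rs ! i, u) \<in> E}" unfolding n by auto
      moreover have "finite (nball E 1 {rs ! i})" unfolding n using True by simp
      ultimately show ?thesis using that assms(2)
        by (simp add: nth_append sum.inter_filter del: One_nat_def)
    next
      \<comment> \<open>\<open>local_fun\<close> also ranges over graphs of infinite degree; there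
        both index sets are infinite and both sums are 0.\<close>
      case False
      then show ?thesis unfolding n by simp
    qed
  qed
  ultimately show ?thesis
    using local_fun_cong[of k "\<lambda>E rs. \<Sum>u\<in>nball E 1 {rs ! i}. if ((rs @ [u]) ! i, (rs @ [u]) ! k) \<in> E then f E (rs @ [u]) else 0"
        "\<lambda>E rs. \<Sum>u\<in>E `` {rs ! i}. f E (rs @ [u])"] by blast
qed

text \<open>A clock moves a walk located at the tail of its directed edge, so these are exactly the
  clocks relevant to walks in \<open>W\<close>.\<close>

definition out_edges :: "(nat \<times> nat) set \<Rightarrow> nat set \<Rightarrow> (nat \<times> nat) set" where
  "out_edges E W = E \<inter> W \<times> UNIV"

text \<open>Both end points of such an edge lie in the unit ball, so the ball isomorphism acts on
  these edges as a bijection.\<close>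

lemma local_fun_card_out_edges: "local_fun k (\<lambda>E rs. card (out_edges E (set rs)))"
proof (rule local_funI[where r = 1])
  fix E rs E' rs' \<phi>
  assume *: "ball_iso 1 E rs E' rs' \<phi>" "rs' = map \<phi> rs"
  let ?B = "nball E 1 (set rs)" and ?B' = "nball E' 1 (set rs')"
  have bij: "bij_betw \<phi> ?B ?B'" using * by (simp add: ball_iso_def partial_iso_def)
  have nb: "x \<in> ?B" if "x \<in> set rs" for x using that subset_nball by auto
  have inB: "y \<in> ?B" if "(x, y) \<in> E" "x \<in> set rs" for x y
    unfolding nball_def using that by (intro CollectI bexI[of _ x] exI[of _ 1]) auto
  have inB': "y \<in> ?B'" if "(x, y) \<in> E'" "x \<in> set rs'" for x y
    unfolding nball_def using that by (intro CollectI bexI[of _ x] exI[of _ 1]) auto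
  have "bij_betw (map_prod \<phi> \<phi>) (out_edges E (set rs)) (out_edges E' (set rs'))"
    unfolding bij_betw_def
  proof
    show "inj_on (map_prod \<phi> \<phi>) (out_edges E (set rs))"
    proof (rule inj_on_subset)
      show "inj_on (map_prod \<phi> \<phi>) (?B \<times> ?B)"
        by (rule map_prod_inj_on) (rule ball_iso_inj[OF *(1)])+
      show "out_edges E (set rs) \<subseteq> ?B \<times> ?B"
        unfolding out_edges_def using nb inB by blast
    qed
    show "map_prod \<phi> \<phi> ` out_edges E (set rs) = out_edges E' (set rs')"
    proof (intro equalityI subsetI)
      fix e assume "e \<in> map_prod \<phi> \<phi> ` out_edges E (set rs)"
      then obtain x y where e: "e = (\<phi> x, \<phi> y)" "(x, y) \<in> E" "x \<in> set rs"
        by (auto simp: out_edges_def)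
      have "(\<phi> x, \<phi> y) \<in> E'" using ball_iso_edge[OF *(1) nb[OF e(3)] inB[OF e(2,3)]] e(2) by blast
      then show "e \<in> out_edges E' (set rs')" using e *(2) by (simp add: out_edges_def)
    next
      fix e assume "e \<in> out_edges E' (set rs')"
      then obtain x y' where e: "e = (\<phi> x, y')" "x \<in> set rs" "(\<phi> x, y') \<in> E'"
        using *(2) by (auto simp: out_edges_def)
      have "y' \<in> ?B'" using inB'[OF e(3)] e(2) *(2) by auto
      then obtain y where y: "y \<in> ?B" "y' = \<phi> y" using bij by (auto simp: bij_betw_def)
      then have "(x, y) \<in> E" using ball_iso_edge[OF *(1) nb[OF e(2)] y(1)] e(3) by blast
      then have "(x, y) \<in> out_edges E (set rs)" using e(2) by (simp add: out_edges_def)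
      then show "e \<in> map_prod \<phi> \<phi> ` out_edges E (set rs)"
        using e(1) y(2) by (intro image_eqI[of _ _ "(x, y)"]) simp_all
    qed
  qed
  then show "card (out_edges E (set rs)) = card (out_edges E' (set rs'))"
    by (rule bij_betw_same_card)
qed

section \<open>Measurability and mass transport\<close>

lemma rooted_iso_refl: "rooted_iso G G"
  by (cases G) (simp add: rooted_iso_def exI[of _ id])

lemma local_funD_iso:
  assumes "local_fun k f" "rooted_graph k (V, E, rs)" "rooted_graph k (V', E', rs')"
    and "rooted_iso (V, E, rs) (V', E', rs')"
  shows "f E rs = f E' rs'"
proof -
  obtain r where r: "\<forall>E rs E' rs' \<phi>. length rs = k \<longrightarrow> ball_iso r E rs E' rs' \<phi> \<longrightarrow> f E rs = f E' rs'"
    using assms(1) unfolding local_fun_def by auto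
  obtain \<phi> where "ball_iso r E rs E' rs' \<phi>" using rooted_iso_ball_iso[OF assms(2-4)] ..
  then show ?thesis
    by (intro r[rule_format]) (use assms(2) in \<open>simp_all add: rooted_graph_def\<close>)
qed

text \<open>The representative is arbitrary; for local \<open>f\<close> the value does not depend on
  it, by \<open>class_fun_mem\<close>.\<close>

definition class_fun :: "((nat \<times> nat) set \<Rightarrow> nat list \<Rightarrow> 'b) \<Rightarrow> rgraph set \<Rightarrow> 'b" where
  "class_fun f c = (case SOME H. H \<in> c of (V, E, rs) \<Rightarrow> f E rs)"

lemma iso_class_self: "rooted_graph k G \<Longrightarrow> G \<in> iso_class G"
  by (cases G) (auto simp: iso_class_def rooted_iso_refl rooted_graph_def)

lemma iso_classD:
  assumes "H \<in> iso_class G" "rooted_graph k G"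
  shows "rooted_graph k H" "rooted_iso G H"
proof -
  obtain V E rs V' E' rs' where *: "G = (V, E, rs)" "H = (V', E', rs')" by (metis prod_cases3)
  show iso: "rooted_iso G H" using assms(1) by (simp add: iso_class_def)
  then have "length rs' = length rs" using * by (auto simp: rooted_iso_def)
  moreover have "length rs = k" using assms(2) * by (simp add: rooted_graph_def)
  ultimately show "rooted_graph k H" using assms(1) * by (simp add: iso_class_def)
qed

lemma class_fun_mem:
  assumes f: "local_fun k f" and G: "rooted_graph k G" and H: "(V, E, rs) \<in> iso_class G"
  shows "class_fun f (iso_class G) = f E rs"
proof -
  let ?S = "SOME H. H \<in> iso_class G"
  obtain V0 E0 rs0 where G0: "G = (V0, E0, rs0)" by (metis prod_cases3)
  obtain V1 E1 rs1 where S: "?S = (V1, E1, rs1)" by (metis prod_cases3)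
  have "?S \<in> iso_class G" using iso_class_self[OF G] by (rule someI)
  then have S': "(V1, E1, rs1) \<in> iso_class G" by (simp only: S)
  have "f E0 rs0 = f E1 rs1"
    using iso_classD[OF S' G] G unfolding G0 by (intro local_funD_iso[OF f])
  moreover have "f E0 rs0 = f E rs"
    using iso_classD[OF H G] G unfolding G0 by (intro local_funD_iso[OF f])
  ultimately show ?thesis by (simp add: class_fun_def S)
qed

lemma class_fun_iso_class:
  "local_fun k f \<Longrightarrow> rooted_graph k (V, E, rs) \<Longrightarrow> class_fun f (iso_class (V, E, rs)) = f E rs"
  by (rule class_fun_mem) (auto intro: iso_class_self)

lemma space_graph_space [simp]: "space (graph_space k) = iso_classes k"
  and sets_graph_space: "sets (graph_space k) = sigma_sets (iso_classes k) {A. openin (local_topology k) A}"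
proof -
  have "topspace (local_topology k) \<subseteq> iso_classes k"
    unfolding local_topology_def topology_generated_by_topspace by auto
  then have *: "{A. openin (local_topology k) A} \<subseteq> Pow (iso_classes k)"
    by (auto dest: openin_subset)
  show "space (graph_space k) = iso_classes k"
    unfolding graph_space_def by (rule space_measure_of[OF *])
  show "sets (graph_space k) = sigma_sets (iso_classes k) {A. openin (local_topology k) A}"
    unfolding graph_space_def by (rule sets_measure_of[OF *])
qed

text \<open>A local function is locally constant, so all preimages are open.\<close>

lemma measurable_class_fun:
  assumes f: "local_fun k f" and X: "space X = UNIV"
  shows "class_fun f \<in> graph_space k \<rightarrow>\<^sub>M X"
proof (rule measurableI)
  fix A assume "A \<in> sets X"
  obtain r where r: "\<forall>E rs E' rs' \<phi>. length rs = k \<longrightarrow> ball_iso r E rs E' rs' \<phi> \<longrightarrow> f E rs = f E' rs'"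
    using f unfolding local_fun_def by auto
  define \<B> where "\<B> G = {c \<in> iso_classes k. \<exists>H\<in>c. rooted_iso (root_ball r G) (root_ball r H)}" for G
  have eq: "class_fun f -` A \<inter> iso_classes k =
      (\<Union>G\<in>{G. rooted_graph k G \<and> (case G of (V, E, rs) \<Rightarrow> f E rs) \<in> A}. \<B> G)" (is "?L = ?R")
  proof (intro equalityI subsetI)
    fix c assume c: "c \<in> ?L"
    then obtain G where G: "rooted_graph k G" "c = iso_class G" by (auto simp: iso_classes_def)
    then have "(case G of (V, E, rs) \<Rightarrow> f E rs) \<in> A"
      using c class_fun_iso_class[OF f] by (cases G) auto
    moreover have "c \<in> \<B> G"
      unfolding \<B>_def using c iso_class_self[OF G(1)] rooted_iso_refl[of "root_ball r G"] G(2) by blast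
    ultimately show "c \<in> ?R" using G(1) by (intro UN_I[of G]) simp_all
  next
    fix c assume "c \<in> ?R"
    then obtain G where "rooted_graph k G" "(case G of (V, E, rs) \<Rightarrow> f E rs) \<in> A" "c \<in> \<B> G" by blast
    then obtain V E rs H where G: "rooted_graph k (V, E, rs)" "f E rs \<in> A" and c: "c \<in> iso_classes k" "H \<in> c"
        "rooted_iso (root_ball r (V, E, rs)) (root_ball r H)"
      unfolding \<B>_def by (cases G) auto
    obtain V' E' rs' where H: "H = (V', E', rs')" by (metis prod_cases3)
    obtain G0 where G0: "rooted_graph k G0" "c = iso_class G0" using c(1) by (auto simp: iso_classes_def)
    have H': "rooted_graph k (V', E', rs')" using iso_classD(1)[OF _ G0(1)] c(2) G0(2) H by simp
    obtain \<phi> where "ball_iso r E rs E' rs' \<phi>"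
      using c(3) root_ball_iso_iff[OF G(1) H'] H by auto
    then have "f E rs = f E' rs'"
      by (intro r[rule_format]) (use G(1) in \<open>simp_all add: rooted_graph_def\<close>)
    also have "\<dots> = class_fun f c" using class_fun_mem[OF f G0(1)] c(2) G0(2) H by simp
    finally show "c \<in> ?L" using G(2) c(1) by simp
  qed
  have "openin (local_topology k) (\<B> G)" if "rooted_graph k G" for G
    unfolding local_topology_def \<B>_def using that by (intro topology_generated_by_Basis CollectI exI[of _ r] exI[of _ G]) simp
  then have "openin (local_topology k) ?L" unfolding eq by (intro openin_Union) auto
  then show "class_fun f -` A \<inter> space (graph_space k) \<in> sets (graph_space k)"
    by (simp add: sets_graph_space sigma_sets.Basic)
qed (simp add: X)

text \<open>A local function factors through the isomorphism class, the only object whose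
  measurability is given.\<close>

lemma random_rooted_graph_measurable:
  fixes f :: "_ \<Rightarrow> _ \<Rightarrow> ennreal"
  assumes "random_rooted_graph M V E \<rho>" "local_fun 1 f"
  shows "(\<lambda>\<omega>. f (E \<omega>) [\<rho> \<omega>]) \<in> borel_measurable M"
proof -
  have "class_fun f \<in> borel_measurable (graph_space 1)" by (rule measurable_class_fun[OF assms(2)]) simp
  moreover have "(\<lambda>\<omega>. iso_class (V \<omega>, E \<omega>, [\<rho> \<omega>])) \<in> M \<rightarrow>\<^sub>M graph_space 1"
    using assms(1) by (simp add: random_rooted_graph_def)
  ultimately have "(\<lambda>\<omega>. class_fun f (iso_class (V \<omega>, E \<omega>, [\<rho> \<omega>]))) \<in> borel_measurable M"
    by (rule measurable_compose[rotated])
  moreover have "class_fun f (iso_class (V \<omega>, E \<omega>, [\<rho> \<omega>])) = f (E \<omega>) [\<rho> \<omega>]" if "\<omega> \<in> space M" for \<omega>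
    using assms(1) that by (intro class_fun_iso_class[OF assms(2)]) (simp add: random_rooted_graph_def)
  ultimately show ?thesis by (simp cong: measurable_cong)
qed

text \<open>\<open>unimodular\<close> speaks of real-valued functions of the class. Finiteness of
  \<open>f\<close> ensures that passing through \<open>enn2real\<close> loses nothing.\<close>

lemma mass_transport:
  fixes f :: "_ \<Rightarrow> _ \<Rightarrow> ennreal"
  assumes M: "random_rooted_graph M V E \<rho>" "unimodular M V E \<rho>"
    and f: "local_fun 2 f" "\<And>E rs. f E rs \<noteq> \<top>"
  shows "(\<integral>\<^sup>+\<omega>. (\<integral>\<^sup>+x. f (E \<omega>) [\<rho> \<omega>, x] \<partial>count_space (V \<omega>)) \<partial>M) =
    (\<integral>\<^sup>+\<omega>. (\<integral>\<^sup>+x. f (E \<omega>) [x, \<rho> \<omega>] \<partial>count_space (V \<omega>)) \<partial>M)"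
proof -
  define F where "F = (\<lambda>c. enn2real (class_fun f c))"
  have "class_fun f \<in> borel_measurable (graph_space 2)" by (rule measurable_class_fun[OF f(1)]) simp
  then have F: "F \<in> borel_measurable (graph_space 2)" unfolding F_def by measurable
  have F_eq: "ennreal (F (iso_class (V \<omega>, E \<omega>, rs))) = f (E \<omega>) rs"
    if "\<omega> \<in> space M" "set rs \<subseteq> V \<omega>" "length rs = 2" for \<omega> rs
  proof -
    have "rooted_graph 2 (V \<omega>, E \<omega>, rs)"
      using M(1) that by (auto simp: random_rooted_graph_def rooted_graph_def)
    from class_fun_iso_class[OF f(1) this] show ?thesis
      using f(2) by (simp add: F_def less_top)
  qed
  have \<rho>: "\<rho> \<omega> \<in> V \<omega>" if "\<omega> \<in> space M" for \<omega>
    using M(1) that by (auto simp: random_rooted_graph_def rooted_graph_def)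
  have "(\<integral>\<^sup>+\<omega>. (\<integral>\<^sup>+x. ennreal (F (iso_class (V \<omega>, E \<omega>, [\<rho> \<omega>, x]))) \<partial>count_space (V \<omega>)) \<partial>M) =
        (\<integral>\<^sup>+\<omega>. (\<integral>\<^sup>+x. ennreal (F (iso_class (V \<omega>, E \<omega>, [x, \<rho> \<omega>]))) \<partial>count_space (V \<omega>)) \<partial>M)"
    using M(2) unfolding unimodular_def by (rule allE[where x = F]) (use F in \<open>simp add: F_def\<close>)
  moreover have "(\<integral>\<^sup>+\<omega>. (\<integral>\<^sup>+x. ennreal (F (iso_class (V \<omega>, E \<omega>, [\<rho> \<omega>, x]))) \<partial>count_space (V \<omega>)) \<partial>M) =
      (\<integral>\<^sup>+\<omega>. (\<integral>\<^sup>+x. f (E \<omega>) [\<rho> \<omega>, x] \<partial>count_space (V \<omega>)) \<partial>M)"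
    by (intro nn_integral_cong F_eq) (auto simp: \<rho>)
  moreover have "(\<integral>\<^sup>+\<omega>. (\<integral>\<^sup>+x. ennreal (F (iso_class (V \<omega>, E \<omega>, [x, \<rho> \<omega>]))) \<partial>count_space (V \<omega>)) \<partial>M) =
      (\<integral>\<^sup>+\<omega>. (\<integral>\<^sup>+x. f (E \<omega>) [x, \<rho> \<omega>] \<partial>count_space (V \<omega>)) \<partial>M)"
    by (intro nn_integral_cong F_eq) (auto simp: \<rho>)
  ultimately show ?thesis by simp
qed

section \<open>A discrete-time pair of coalescing walks\<close>

text \<open>The probability that none of the unit-rate clocks at vertices of \<open>W\<close> rings
  during a step of length \<open>h\<close>.\<close>

definition quiet_weight :: "real \<Rightarrow> (nat \<times> nat) set \<Rightarrow> nat set \<Rightarrow> ennreal" where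
  "quiet_weight h E W = ennreal (exp (- h * real (card (out_edges E W))))"

text \<open>Off the diagonal this is the probability that the clock of \<open>(x, u)\<close> rings
  once and all other clocks at \<open>x\<close> and \<open>u\<close> are silent: a factor
  \<open>h * exp (- h)\<close> for the one and \<open>exp (- h)\<close> for each of the
  others.\<close>

definition walk_kernel :: "real \<Rightarrow> (nat \<times> nat) set \<Rightarrow> nat \<Rightarrow> nat \<Rightarrow> ennreal" where
  "walk_kernel h E x u =
     (if u = x then quiet_weight h E {x}
      else if (x, u) \<in> E then ennreal h * quiet_weight h E {x, u} else 0)"

text \<open>The action of \<open>walk_kernel\<close> on functions, written as a sum over neighbours
  so that its locality is visible; \<open>walk_op_kernel\<close> gives the integral form, where
  symmetry can be used.\<close>

definition walk_op :: "real \<Rightarrow> (nat \<times> nat) set \<Rightarrow> (nat \<Rightarrow> ennreal) \<Rightarrow> nat \<Rightarrow> ennreal" where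
  "walk_op h E f x = quiet_weight h E {x} * f x +
     (\<Sum>u\<in>E `` {x}. ennreal h * quiet_weight h E {x, u} * f u)"

text \<open>
  \<open>pair_prob h E n z a b\<close>: the pair started at \<open>(a, b)\<close> is at \<open>(z, z)\<close> after \<open>n\<close> steps without having
  been killed. Once the two walks agree they move together.
\<close>

primrec pair_prob ::
  "real \<Rightarrow> (nat \<times> nat) set \<Rightarrow> nat \<Rightarrow> nat \<Rightarrow> nat \<Rightarrow> nat \<Rightarrow> ennreal" where
  "pair_prob h E 0 z = (\<lambda>a b. if a = z \<and> b = z then 1 else 0)"
| "pair_prob h E (Suc n) z = (\<lambda>a b.
     quiet_weight h E {a, b} * pair_prob h E n z a b
     + (\<Sum>u\<in>E `` {a}. ennreal h * quiet_weight h E {a, b, u} *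
          pair_prob h E n z u (if a = b then u else b))
     + (if a = b then 0 else
          \<Sum>v\<in>E `` {b}. ennreal h * quiet_weight h E {a, b, v} * pair_prob h E n z a v))"

text \<open>The sum over \<open>b\<close> of the merging term \<open>2 * h\<close> in
  \<open>meet_off_Suc\<close>, which is present only for neighbours \<open>b\<close> of
  \<open>a\<close>.\<close>

definition merge_rate :: "real \<Rightarrow> (nat \<times> nat) set \<Rightarrow> nat \<Rightarrow> ennreal" where
  "merge_rate h E a = 2 * ennreal h * of_nat (card (E `` {a}))"

lemma quiet_weight_le_1: "0 \<le> h \<Longrightarrow> quiet_weight h E W \<le> 1"
  unfolding quiet_weight_def ennreal_1[symmetric] by (intro ennreal_leI) simp

lemma finite_out_edges:
  assumes "\<And>v. finite (E `` {v})" "finite W"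
  shows "finite (out_edges E W)"
proof -
  have "out_edges E W = (\<Union>w\<in>W. Pair w ` (E `` {w}))" unfolding out_edges_def by auto
  then show ?thesis using assms by simp
qed

lemma card_out_edges_singleton: "card (out_edges E {x}) = card (E `` {x})"
proof -
  have "out_edges E {x} = Pair x ` (E `` {x})" unfolding out_edges_def by auto
  then show ?thesis by (simp add: card_image inj_on_def)
qed

lemma nn_integral_count_space_swap:
  fixes f :: "nat \<Rightarrow> nat \<Rightarrow> ennreal"
  shows "(\<integral>\<^sup>+x. \<integral>\<^sup>+y. f x y \<partial>count_space UNIV \<partial>count_space UNIV) =
    (\<integral>\<^sup>+y. \<integral>\<^sup>+x. f x y \<partial>count_space UNIV \<partial>count_space UNIV)"
  using nn_integral_fst_count_space[of "case_prod f"] nn_integral_snd_count_space[of "case_prod f"]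
  by simp

lemma nn_integral_count_space_if_eq:
  "(\<integral>\<^sup>+y. (if y = a then c else 0) \<partial>count_space UNIV) = (c :: ennreal)"
proof -
  have "(\<integral>\<^sup>+y. (if y = a then c else 0) \<partial>count_space UNIV) = (\<integral>\<^sup>+y. c * indicator {a} y \<partial>count_space UNIV)"
    by (intro nn_integral_cong) auto
  then show ?thesis by (simp add: nn_integral_cmult_indicator)
qed

lemma nn_integral_count_space_linear:
  fixes f g :: "'b \<Rightarrow> ennreal"
  shows "(\<integral>\<^sup>+x. f x + g x \<partial>count_space A) = (\<integral>\<^sup>+x. f x \<partial>count_space A) + (\<integral>\<^sup>+x. g x \<partial>count_space A)"
    and "(\<integral>\<^sup>+x. c * f x \<partial>count_space A) = c * (\<integral>\<^sup>+x. f x \<partial>count_space A)"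
    and "(\<integral>\<^sup>+x. (\<Sum>i\<in>I. F i x) \<partial>count_space A) = (\<Sum>i\<in>I. \<integral>\<^sup>+x. F i x \<partial>count_space A)"
  by (simp_all add: nn_integral_add nn_integral_cmult nn_integral_sum)

lemma walk_op_mono: "(\<And>u. f u \<le> g u) \<Longrightarrow> walk_op h E f x \<le> walk_op h E g x"
  unfolding walk_op_def by (intro add_mono sum_mono mult_left_mono) auto

lemma walk_op_sum:
  "walk_op h E (\<lambda>u. \<Sum>i\<in>I. f i u) x = (\<Sum>i\<in>I. walk_op h E (f i) x)"
  unfolding walk_op_def sum_distrib_left sum.distrib by (subst sum.swap) (rule refl)

locale step_graph =
  fixes h :: real and E :: "(nat \<times> nat) set"
  assumes sym: "sym E" and irrefl: "irrefl E" and finite_nbrs: "\<And>v. finite (E `` {v})"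
    and h_nonneg: "0 \<le> h"
begin

lemma irreflD: "(x, x) \<notin> E"
  using irrefl by (auto simp: irrefl_def)

text \<open>Disjoint sets of vertices have disjoint sets of clocks. This is the source of the
  independence of two walks that have not met.\<close>

lemma quiet_weight_Un:
  assumes "finite A" "finite B" "A \<inter> B = {}"
  shows "quiet_weight h E (A \<union> B) = quiet_weight h E A * quiet_weight h E B"
proof -
  have "out_edges E (A \<union> B) = out_edges E A \<union> out_edges E B" by (auto simp: out_edges_def)
  moreover have "out_edges E A \<inter> out_edges E B = {}" using assms(3) by (auto simp: out_edges_def)
  ultimately have "card (out_edges E (A \<union> B)) = card (out_edges E A) + card (out_edges E B)"
    using finite_out_edges[OF finite_nbrs] assms(1,2) by (simp add: card_Un_disjoint)
  then show ?thesis
    by (simp add: quiet_weight_def ennreal_mult[symmetric] exp_add[symmetric] algebra_simps)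
qed

lemma walk_kernel_sym: "walk_kernel h E x u = walk_kernel h E u x"
  using sym by (auto simp: walk_kernel_def insert_commute dest: symD)

lemma walk_op_kernel:
  "walk_op h E f x = (\<integral>\<^sup>+u. walk_kernel h E x u * f u \<partial>count_space UNIV)"
proof -
  have "(\<integral>\<^sup>+u. walk_kernel h E x u * f u \<partial>count_space UNIV) =
      (\<Sum>u\<in>insert x (E `` {x}). walk_kernel h E x u * f u)"
    by (rule nn_integral_count_space'[where A = "insert x (E `` {x})"])
      (auto simp: walk_kernel_def finite_nbrs)
  also have "\<dots> = quiet_weight h E {x} * f x + (\<Sum>u\<in>E `` {x}. walk_kernel h E x u * f u)"
    using finite_nbrs irreflD by (subst sum.insert) (auto simp: walk_kernel_def)
  also have "(\<Sum>u\<in>E `` {x}. walk_kernel h E x u * f u) =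
      (\<Sum>u\<in>E `` {x}. ennreal h * quiet_weight h E {x, u} * f u)"
    using irreflD by (intro sum.cong) (auto simp: walk_kernel_def)
  finally show ?thesis by (simp add: walk_op_def)
qed

lemma quiet_weight_le_singleton:
  assumes "finite W" "x \<in> W"
  shows "quiet_weight h E W \<le> quiet_weight h E {x}"
proof -
  have "W = {x} \<union> (W - {x})" using assms by auto
  then have "quiet_weight h E W = quiet_weight h E {x} * quiet_weight h E (W - {x})"
    using quiet_weight_Un[of "{x}" "W - {x}"] assms(1) by auto
  then show ?thesis 
    using mult_left_mono[OF quiet_weight_le_1[OF h_nonneg, of E "W - {x}"], of "quiet_weight h E {x}"]
    by simp
qed

text \<open>Dropping the silence required at the target leaves the probability
  \<open>(1 + h * d) * exp (- h * d)\<close> of at most one ring among the \<open>d\<close> clocks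
  at \<open>x\<close>, and \<open>1 + y \<le> exp y\<close>.\<close>

lemma walk_op_1_le: "walk_op h E (\<lambda>_. 1) x \<le> 1"
proof -
  let ?d = "real (card (E `` {x}))"
  have "walk_op h E (\<lambda>_. 1) x \<le>
      quiet_weight h E {x} + (\<Sum>u\<in>E `` {x}. ennreal h * quiet_weight h E {x})"
    unfolding walk_op_def
    by (intro add_mono sum_mono) (auto intro!: mult_left_mono quiet_weight_le_singleton)
  also have "\<dots> = ennreal ((1 + h * ?d) * exp (- h * ?d))"
    using h_nonneg
    by (simp add: quiet_weight_def card_out_edges_singleton ennreal_of_nat_eq_real_of_nat
        ennreal_mult[symmetric] ennreal_plus[symmetric] distrib_right mult_ac del: ennreal_plus)
  also have "\<dots> \<le> ennreal (exp (h * ?d) * exp (- h * ?d))"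
    by (intro ennreal_leI mult_right_mono) auto
  also have "\<dots> = 1" by (simp add: exp_add[symmetric])
  finally show ?thesis .
qed

text \<open>By symmetry of the kernel, column sums are row sums and hence at most 1.\<close>

lemma nn_integral_walk_op_le:
  "(\<integral>\<^sup>+x. walk_op h E f x \<partial>count_space UNIV) \<le> (\<integral>\<^sup>+x. f x \<partial>count_space UNIV)"
proof -
  have "(\<integral>\<^sup>+x. walk_op h E f x \<partial>count_space UNIV) =
      (\<integral>\<^sup>+u. \<integral>\<^sup>+x. f u * (walk_kernel h E u x * 1) \<partial>count_space UNIV \<partial>count_space UNIV)"
    unfolding walk_op_kernel
    by (subst nn_integral_count_space_swap) (simp add: walk_kernel_sym mult.commute)
  also have "\<dots> = (\<integral>\<^sup>+u. f u * walk_op h E (\<lambda>_. 1) u \<partial>count_space UNIV)"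
    unfolding walk_op_kernel nn_integral_count_space_linear ..
  also have "\<dots> \<le> (\<integral>\<^sup>+u. f u * 1 \<partial>count_space UNIV)"
    by (intro nn_integral_mono mult_left_mono walk_op_1_le) simp
  finally show ?thesis by simp
qed

text \<open>The probability that the pair started at \<open>(a, b)\<close> is alive and has merged
  after \<open>n\<close> steps, at any place.\<close>

definition meet_prob :: "nat \<Rightarrow> nat \<Rightarrow> nat \<Rightarrow> ennreal" where
  "meet_prob n a b = (\<integral>\<^sup>+z. pair_prob h E n z a b \<partial>count_space UNIV)"

lemma meet_prob_Suc:
  "meet_prob (Suc n) a b =
     quiet_weight h E {a, b} * meet_prob n a b
     + (\<Sum>u\<in>E `` {a}. ennreal h * quiet_weight h E {a, b, u} * meet_prob n u (if a = b then u else b))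
     + (if a = b then 0 else \<Sum>v\<in>E `` {b}. ennreal h * quiet_weight h E {a, b, v} * meet_prob n a v)"
  by (cases "a = b")
    (simp_all only: meet_prob_def pair_prob.simps nn_integral_count_space_linear if_True if_False
      nn_integral_const mult_zero_left add_0_right simp_thms)

text \<open>A merged pair moves as a single walk, so this is the row-sum bound, iterated.\<close>

lemma meet_prob_diag: "meet_prob n a a \<le> 1"
proof (induction n arbitrary: a)
  case 0
  have "(\<lambda>z. pair_prob h E 0 z a a) = (\<lambda>z. if z = a then 1 else 0)" by auto
  then show ?case by (simp only: meet_prob_def nn_integral_count_space_if_eq)
next
  case (Suc n)
  have "meet_prob (Suc n) a a = walk_op h E (\<lambda>u. meet_prob n u u) a"
    by (simp add: meet_prob_Suc walk_op_def)
  also have "\<dots> \<le> walk_op h E (\<lambda>_. 1) a" by (intro walk_op_mono Suc.IH)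
  finally show ?case using walk_op_1_le order_trans by blast
qed

definition meet_off :: "nat \<Rightarrow> nat \<Rightarrow> nat \<Rightarrow> ennreal" where
  "meet_off n a b = (if a = b then 0 else meet_prob n a b)"

text \<open>
  The first summand bounds the probability of merging in this step; a pair that does not merge is
  dominated by two independent walks.
\<close>

lemma meet_off_Suc:
  "meet_off (Suc n) a b \<le> (if (a, b) \<in> E then 2 * ennreal h else 0)
     + walk_op h E (\<lambda>u. walk_op h E (\<lambda>v. meet_off n u v) b) a"
proof (cases "a = b")
  case False
  let ?m = "if (a, b) \<in> E then ennreal h else 0"
  let ?q = "quiet_weight h E" and ?D = "meet_off n"
  \<comment> \<open>A jump onto \<open>b\<close> merges the pair and costs at most \<open>h\<close>.
    Any other jump leaves the clocks at \<open>{a, u}\<close> and at \<open>b\<close> disjoint, and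
    the weight factors into a moving and a resting walk.\<close>
  have u: "ennreal h * ?q {a, b, u} * meet_prob n u b
      \<le> ennreal h * ?q {a, u} * (?q {b} * ?D u b) + (if u = b then ?m else 0)"
    if "u \<in> E `` {a}" for u
  proof (cases "u = b")
    case True
    have "ennreal h * ?q {a, b, u} * meet_prob n u b \<le> ennreal h * 1 * 1"
      using True meet_prob_diag by (intro mult_mono quiet_weight_le_1 h_nonneg) auto
    then show ?thesis using True that by (auto intro: add_increasing)
  next
    case ub: False
    have "u \<noteq> a" using that irreflD by auto
    then have "?q {a, b, u} = ?q {a, u} * ?q {b}"
      using quiet_weight_Un[of "{a, u}" "{b}"] False ub by (simp add: insert_commute)
    then show ?thesis using ub by (simp add: meet_off_def mult.assoc)
  qed
  have v: "ennreal h * ?q {a, b, v} * meet_prob n a v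
      \<le> ?q {a} * (ennreal h * ?q {b, v} * ?D a v) + (if v = a then ?m else 0)"
    if "v \<in> E `` {b}" for v
  proof (cases "v = a")
    case True
    have "ennreal h * ?q {a, b, v} * meet_prob n a v \<le> ennreal h * 1 * 1"
      using True meet_prob_diag by (intro mult_mono quiet_weight_le_1 h_nonneg) auto
    moreover have "(a, b) \<in> E" using that True sym by (auto dest: symD)
    ultimately show ?thesis using True by (auto intro: add_increasing)
  next
    case va: False
    have "v \<noteq> b" using that irreflD by auto
    then have "?q {a, b, v} = ?q {a} * ?q {b, v}"
      using quiet_weight_Un[of "{a}" "{b, v}"] False va by (simp add: insert_commute)
    then show ?thesis using va by (simp add: meet_off_def mult_ac)
  qed
  have "meet_off (Suc n) a b = ?q {a, b} * ?D a b
      + (\<Sum>u\<in>E `` {a}. ennreal h * ?q {a, b, u} * meet_prob n u b)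
      + (\<Sum>v\<in>E `` {b}. ennreal h * ?q {a, b, v} * meet_prob n a v)"
    using False by (simp add: meet_off_def meet_prob_Suc)
  also have "\<dots> \<le> ?q {a, b} * ?D a b
      + (\<Sum>u\<in>E `` {a}. ennreal h * ?q {a, u} * (?q {b} * ?D u b) + (if u = b then ?m else 0))
      + (\<Sum>v\<in>E `` {b}. ?q {a} * (ennreal h * ?q {b, v} * ?D a v) + (if v = a then ?m else 0))"
    by (intro add_mono sum_mono u v order_refl)
  \<comment> \<open>Each sum of merging terms has at most one nonzero entry, and there are two such
    sums: this is the factor 2.\<close>
  also have "\<dots> \<le> ?q {a} * (?q {b} * ?D a b)
      + ((\<Sum>u\<in>E `` {a}. ennreal h * ?q {a, u} * (?q {b} * ?D u b)) + ?m)
      + ((\<Sum>v\<in>E `` {b}. ?q {a} * (ennreal h * ?q {b, v} * ?D a v)) + ?m)"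
    using quiet_weight_Un[of "{a}" "{b}"] False finite_nbrs
    by (intro add_mono) (auto simp: sum.distrib mult.assoc insert_commute)
  also have "\<dots> = (if (a, b) \<in> E then 2 * ennreal h else 0) +
      (?q {a} * walk_op h E (\<lambda>v. ?D a v) b + (\<Sum>u\<in>E `` {a}. ennreal h * ?q {a, u} * (?q {b} * ?D u b)))"
    by (simp add: walk_op_def sum_distrib_left distrib_left mult_2 add_ac)
  \<comment> \<open>Independent walks may also both move in one step, which the pair may not; these
    missing terms are nonnegative and are added here.\<close>
  also have "\<dots> \<le> (if (a, b) \<in> E then 2 * ennreal h else 0) +
      (?q {a} * walk_op h E (\<lambda>v. ?D a v) b + (\<Sum>u\<in>E `` {a}. ennreal h * ?q {a, u} * walk_op h E (\<lambda>v. ?D u v) b))"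
    by (intro add_mono sum_mono mult_left_mono order_refl) (simp_all add: walk_op_def)
  finally show ?thesis by (simp add: walk_op_def[of _ _ _ a])
qed (simp add: meet_off_def)

text \<open>Summing \<open>meet_off_Suc\<close> over \<open>b\<close> removes the second walk and
  leaves the recursion \<open>S (Suc n) \<le> merge_rate + walk_op (S n)\<close>, which is unrolled
  along the first walk.\<close>

lemma nn_integral_meet_off_le:
  "(\<integral>\<^sup>+b. meet_off n a b \<partial>count_space UNIV) \<le> (\<Sum>k<n. (walk_op h E ^^ k) (merge_rate h E) a)"
proof (induction n arbitrary: a)
  case 0
  have "meet_off 0 a b = 0" for b
    by (auto simp: meet_off_def meet_prob_def nn_integral_0_iff_AE AE_count_space)
  then show ?case by simp
next
  case (Suc n)
  let ?S = "\<lambda>a. \<integral>\<^sup>+b. meet_off n a b \<partial>count_space UNIV"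
  have "(\<integral>\<^sup>+b. meet_off (Suc n) a b \<partial>count_space UNIV) \<le>
      (\<integral>\<^sup>+b. 2 * ennreal h * indicator (E `` {a}) b
        + walk_op h E (\<lambda>u. walk_op h E (\<lambda>v. meet_off n u v) b) a \<partial>count_space UNIV)"
    by (intro nn_integral_mono order_trans[OF meet_off_Suc]) (auto simp: indicator_def)
  also have "\<dots> = merge_rate h E a +
      (\<integral>\<^sup>+b. walk_op h E (\<lambda>u. walk_op h E (\<lambda>v. meet_off n u v) b) a \<partial>count_space UNIV)"
    using finite_nbrs by (simp add: nn_integral_count_space_linear merge_rate_def)
  also have "(\<integral>\<^sup>+b. walk_op h E (\<lambda>u. walk_op h E (\<lambda>v. meet_off n u v) b) a \<partial>count_space UNIV) =
      walk_op h E (\<lambda>u. \<integral>\<^sup>+b. walk_op h E (\<lambda>v. meet_off n u v) b \<partial>count_space UNIV) a"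
    unfolding walk_op_kernel[of _ a]
    by (subst nn_integral_count_space_swap) (simp only: nn_integral_count_space_linear)
  \<comment> \<open>The column bound is applied to the second walk, so only the step of the first
    one remains.\<close>
  also have "\<dots> \<le> walk_op h E ?S a" by (intro walk_op_mono nn_integral_walk_op_le)
  also have "\<dots> \<le> walk_op h E (\<lambda>a. \<Sum>k<n. (walk_op h E ^^ k) (merge_rate h E) a) a"
    by (intro walk_op_mono Suc.IH)
  also have "merge_rate h E a + \<dots> = (\<Sum>k<Suc n. (walk_op h E ^^ k) (merge_rate h E) a)"
    unfolding walk_op_sum by (subst sum.lessThan_Suc_shift) simp
  finally show ?case by (simp add: add_left_mono)
qed

text \<open>The starting point \<open>y = a\<close> contributes at most 1; all others are pairs
  started apart.\<close>

lemma nn_integral_pair_prob_le: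
  "(\<integral>\<^sup>+x. \<integral>\<^sup>+y. pair_prob h E n x a y \<partial>count_space UNIV \<partial>count_space UNIV)
    \<le> 1 + (\<Sum>k<n. (walk_op h E ^^ k) (merge_rate h E) a)"
proof -
  have "(\<integral>\<^sup>+x. \<integral>\<^sup>+y. pair_prob h E n x a y \<partial>count_space UNIV \<partial>count_space UNIV) =
      (\<integral>\<^sup>+y. (if y = a then meet_prob n a a else 0) + meet_off n a y \<partial>count_space UNIV)"
    by (subst nn_integral_count_space_swap)
      (auto simp: meet_off_def meet_prob_def intro!: nn_integral_cong)
  also have "\<dots> = meet_prob n a a + (\<integral>\<^sup>+y. meet_off n a y \<partial>count_space UNIV)"
    by (simp add: nn_integral_count_space_linear nn_integral_count_space_if_eq)
  also have "\<dots> \<le> 1 + (\<Sum>k<n. (walk_op h E ^^ k) (merge_rate h E) a)"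
    by (intro add_mono meet_prob_diag nn_integral_meet_off_le)
  finally show ?thesis .
qed

end

section \<open>Locality and finiteness of the transition probabilities\<close>

lemma local_fun_quiet_weight:
  assumes "\<forall>i\<in>set ns. i < k"
  shows "local_fun k (\<lambda>E rs. quiet_weight h E ((!) rs ` set ns))"
proof -
  have "local_fun (length ns) (\<lambda>E rs. quiet_weight h E (set rs))"
    unfolding quiet_weight_def
    by (rule local_fun_comp[where F = "\<lambda>n. ennreal (exp (- h * real n))", OF local_fun_card_out_edges])
  from local_fun_reindex[OF this] assms show ?thesis by simp
qed

lemma local_fun_pair_prob:
  "local_fun 3 (\<lambda>E rs. pair_prob h E n (rs ! 0) (rs ! 1) (rs ! 2))"
proof (induction n)
  case 0
  have "local_fun 3 (\<lambda>E rs. if rs ! 1 = rs ! 0 then if rs ! 2 = rs ! 0 then 1 else 0 else 0 :: ennreal)"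
    by (intro local_fun_if local_fun_eq local_fun_const) auto
  moreover have "(\<lambda>E rs. pair_prob h E 0 (rs ! 0) (rs ! 1) (rs ! 2)) =
      (\<lambda>E rs. if rs ! 1 = rs ! 0 then if rs ! 2 = rs ! 0 then 1 else 0 else 0 :: ennreal)"
    by (intro ext) simp
  ultimately show ?case by (simp only:)
next
  case (Suc n)
  \<comment> \<open>In the recursion the moving vertex is appended as root number 3. The arguments
    of the earlier probabilities are then other selections of roots, so the hypothesis is needed for
    all choices of indices.\<close>
  have IH: "local_fun k (\<lambda>E rs. pair_prob h E n (rs ! i) (rs ! j) (rs ! l))" if "i < k" "j < k" "l < k" for i j k l
    using local_fun_reindex[of "[i, j, l]" "\<lambda>E rs. pair_prob h E n (rs ! 0) (rs ! 1) (rs ! 2)" k] Suc that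
    by (auto simp: numeral_3_eq_3 numeral_2_eq_2)
  have q2: "local_fun k (\<lambda>E rs. quiet_weight h E {rs ! i, rs ! j})" if "i < k" "j < k" for i j k
    using local_fun_quiet_weight[of "[i, j]" k h] that by auto
  have q3: "local_fun k (\<lambda>E rs. ennreal h * quiet_weight h E {rs ! i, rs ! j, rs ! l})"
    if "i < k" "j < k" "l < k" for i j k l
    using local_fun_comp[OF local_fun_quiet_weight[of "[i, j, l]" k h], where F = "(*) (ennreal h)"] that
    by auto
  let ?A = "\<lambda>E rs. quiet_weight h E {rs ! 1, rs ! 2} * pair_prob h E n (rs ! 0) (rs ! 1) (rs ! 2)"
  let ?b = "\<lambda>E rs. ennreal h * quiet_weight h E {rs ! 1, rs ! 2, rs ! 3} *
      (if rs ! 1 = rs ! 2 then pair_prob h E n (rs ! 0) (rs ! 3) (rs ! 3) else pair_prob h E n (rs ! 0) (rs ! 3) (rs ! 2))"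
  let ?B = "\<lambda>E rs. \<Sum>u\<in>E `` {rs ! 1}. ?b E (rs @ [u])"
  let ?c = "\<lambda>E rs. ennreal h * quiet_weight h E {rs ! 1, rs ! 2, rs ! 3} * pair_prob h E n (rs ! 0) (rs ! 1) (rs ! 3)"
  let ?C = "\<lambda>E rs. if rs ! 1 = rs ! 2 then 0 else \<Sum>u\<in>E `` {rs ! 2}. ?c E (rs @ [u])"
  have A: "local_fun 3 ?A" by (rule local_fun_comp2[where F = "(*)"]) (auto intro: IH q2)
  have "local_fun 4 ?b"
    by (rule local_fun_comp2[where F = "(*)"]) (auto intro!: IH q3 local_fun_if local_fun_eq)
  then have B: "local_fun 3 ?B" by (intro local_fun_sum_nbrs) auto
  have "local_fun 4 ?c" by (rule local_fun_comp2[where F = "(*)"]) (auto intro!: IH q3)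
  then have C: "local_fun 3 ?C"
    by (intro local_fun_if local_fun_eq local_fun_const local_fun_sum_nbrs) auto
  have AB: "local_fun 3 (\<lambda>E rs. ?A E rs + ?B E rs)"
    by (rule local_fun_comp2[where F = "(+)", OF A B])
  have ABC: "local_fun 3 (\<lambda>E rs. ?A E rs + ?B E rs + ?C E rs)"
    by (rule local_fun_comp2[where F = "(+)", OF AB C])
  have "local_fun 3 (\<lambda>E rs. pair_prob h E (Suc n) (rs ! 0) (rs ! 1) (rs ! 2)) \<longleftrightarrow>
      local_fun 3 (\<lambda>E rs. ?A E rs + ?B E rs + ?C E rs)"
  proof (rule local_fun_cong)
    fix E and rs :: "nat list" assume rs: "length rs = 3"
    have n: "(rs @ [u]) ! 0 = rs ! 0" "(rs @ [u]) ! 1 = rs ! 1" "(rs @ [u]) ! 2 = rs ! 2" "(rs @ [u]) ! 3 = u" for u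
      using rs by (simp_all add: nth_append)
    show "pair_prob h E (Suc n) (rs ! 0) (rs ! 1) (rs ! 2) = ?A E rs + ?B E rs + ?C E rs"
      unfolding n pair_prob.simps by (cases "rs ! 1 = rs ! 2") (simp_all only: if_True if_False simp_thms)
  qed
  with ABC show ?case by (simp only:)
qed

lemma quiet_weight_neq_top: "quiet_weight h E W \<noteq> \<top>"
  by (simp add: quiet_weight_def)

lemma sum_neq_top: "(\<And>i. i \<in> I \<Longrightarrow> f i \<noteq> (\<top> :: ennreal)) \<Longrightarrow> sum f I \<noteq> \<top>"
  by (cases "finite I") auto

text \<open>Supplies the finiteness hypothesis of \<open>mass_transport\<close>.\<close>

lemma pair_prob_neq_top: "pair_prob h E n z a b \<noteq> \<top>"
proof (induction n arbitrary: a b)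
  case (Suc n)
  have "ennreal h * quiet_weight h E W * pair_prob h E n z u v \<noteq> \<top>"
    and "quiet_weight h E W * pair_prob h E n z u v \<noteq> \<top>" for W u v
    using Suc by (simp_all add: ennreal_mult_eq_top_iff quiet_weight_neq_top)
  then show ?case by (simp add: sum_neq_top)
qed simp

lemma local_fun_walk_kernel:
  "local_fun 2 (\<lambda>E rs. walk_kernel h E (rs ! 0) (rs ! 1))"
proof -
  have "local_fun 2 (\<lambda>E rs. quiet_weight h E {rs ! 0})"
    using local_fun_quiet_weight[of "[0]" 2 h] by simp
  moreover have "local_fun 2 (\<lambda>E rs. ennreal h * quiet_weight h E {rs ! 0, rs ! 1})"
    using local_fun_comp[OF local_fun_quiet_weight[of "[0, 1]" 2 h], where F = "(*) (ennreal h)"] by auto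
  ultimately show ?thesis
    unfolding walk_kernel_def
    by (intro local_fun_if local_fun_eq local_fun_adj local_fun_const) auto
qed

lemma walk_kernel_neq_top: "walk_kernel h E x u \<noteq> \<top>"
  by (simp add: walk_kernel_def ennreal_mult_eq_top_iff quiet_weight_neq_top)

section \<open>Expectations of the walk operator at the root\<close>

lemma rooted_graph_step_graph:
  assumes "rooted_graph k (V, E, rs)" "0 \<le> h"
  shows "step_graph h E"
proof
  show "finite (E `` {v})" for v
  proof (cases "v \<in> V")
    case False
    then have "E `` {v} = {}" using assms(1) by (auto simp: rooted_graph_def)
    then show ?thesis by simp
  qed (use assms(1) in \<open>auto simp: rooted_graph_def\<close>)
qed (use assms in \<open>auto simp: rooted_graph_def\<close>)

lemma random_rooted_graphD:
  assumes "random_rooted_graph M V E \<rho>" "\<omega> \<in> space M"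
  shows "rooted_graph 1 (V \<omega>, E \<omega>, [\<rho> \<omega>])" "\<rho> \<omega> \<in> V \<omega>" "E \<omega> \<subseteq> V \<omega> \<times> V \<omega>"
  using assms by (auto simp: random_rooted_graph_def rooted_graph_def)

lemma nn_integral_count_space_subset:
  assumes "\<And>x. x \<notin> A \<Longrightarrow> f x = 0"
  shows "(\<integral>\<^sup>+x. f x \<partial>count_space A) = (\<integral>\<^sup>+x. f x \<partial>count_space UNIV)"
proof -
  have "(\<integral>\<^sup>+x. f x \<partial>count_space A) = (\<integral>\<^sup>+x. f x * indicator A x \<partial>count_space UNIV)"
    by (simp add: nn_integral_restrict_space[symmetric] restrict_count_space)
  also have "\<dots> = (\<integral>\<^sup>+x. f x \<partial>count_space UNIV)"
    using assms by (intro nn_integral_cong) (auto simp: indicator_def)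
  finally show ?thesis .
qed

text \<open>The walk is symmetric and substochastic, so mass transport makes it decrease expectations.\<close>

lemma nn_integral_walk_op_root_le:
  fixes g :: "(nat \<times> nat) set \<Rightarrow> nat \<Rightarrow> ennreal"
  assumes M: "random_rooted_graph M V E \<rho>" "unimodular M V E \<rho>" and h: "0 \<le> h"
    and g: "local_fun 1 (\<lambda>E rs. g E (rs ! 0))" "\<And>E x. g E x \<noteq> \<top>"
  shows "(\<integral>\<^sup>+\<omega>. walk_op h (E \<omega>) (g (E \<omega>)) (\<rho> \<omega>) \<partial>M) \<le> (\<integral>\<^sup>+\<omega>. g (E \<omega>) (\<rho> \<omega>) \<partial>M)"
proof -
  let ?f = "\<lambda>E rs. walk_kernel h E (rs ! 0) (rs ! 1) * g E (rs ! 1)"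
  have "local_fun 2 (\<lambda>E rs. g E (rs ! 1))" using local_fun_reindex[of "[1]" "\<lambda>E rs. g E (rs ! 0)" 2] g(1) by simp
  then have f: "local_fun 2 ?f"
    by (rule local_fun_comp2[where F = "(*)", OF local_fun_walk_kernel])
  have graph: "step_graph h (E \<omega>)" "\<rho> \<omega> \<in> V \<omega>" "E \<omega> \<subseteq> V \<omega> \<times> V \<omega>" if "\<omega> \<in> space M" for \<omega>
    using random_rooted_graphD[OF M(1) that] rooted_graph_step_graph[OF random_rooted_graphD(1)[OF M(1) that] h]
    by auto
  have kernel_0: "walk_kernel h (E \<omega>) (\<rho> \<omega>) x = 0" if "\<omega> \<in> space M" "x \<notin> V \<omega>" for \<omega> x
    using graph[OF that(1)] that(2) by (auto simp: walk_kernel_def)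
  have "(\<integral>\<^sup>+\<omega>. walk_op h (E \<omega>) (g (E \<omega>)) (\<rho> \<omega>) \<partial>M) =
      (\<integral>\<^sup>+\<omega>. (\<integral>\<^sup>+x. ?f (E \<omega>) [\<rho> \<omega>, x] \<partial>count_space (V \<omega>)) \<partial>M)"
    by (intro nn_integral_cong) (simp add: step_graph.walk_op_kernel[OF graph(1)] nn_integral_count_space_subset kernel_0)
  \<comment> \<open>With the roles of the two roots exchanged, \<open>g\<close> is evaluated at the
    root and leaves the sum; what remains is a row sum of the symmetric kernel.\<close>
  also have "\<dots> = (\<integral>\<^sup>+\<omega>. (\<integral>\<^sup>+x. ?f (E \<omega>) [x, \<rho> \<omega>] \<partial>count_space (V \<omega>)) \<partial>M)"
    by (rule mass_transport[OF M f]) (simp add: ennreal_mult_eq_top_iff walk_kernel_neq_top g(2))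
  also have "\<dots> = (\<integral>\<^sup>+\<omega>. g (E \<omega>) (\<rho> \<omega>) * walk_op h (E \<omega>) (\<lambda>_. 1) (\<rho> \<omega>) \<partial>M)"
  proof (intro nn_integral_cong)
    fix \<omega> assume \<omega>: "\<omega> \<in> space M"
    interpret step_graph h "E \<omega>" by (rule graph(1)[OF \<omega>])
    have "(\<integral>\<^sup>+x. ?f (E \<omega>) [x, \<rho> \<omega>] \<partial>count_space (V \<omega>)) =
        (\<integral>\<^sup>+x. g (E \<omega>) (\<rho> \<omega>) * (walk_kernel h (E \<omega>) (\<rho> \<omega>) x * 1) \<partial>count_space UNIV)"
      using kernel_0[OF \<omega>] by (subst nn_integral_count_space_subset) (auto simp: walk_kernel_sym[of _ "\<rho> \<omega>"] mult_ac)
    then show "(\<integral>\<^sup>+x. ?f (E \<omega>) [x, \<rho> \<omega>] \<partial>count_space (V \<omega>)) =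
        g (E \<omega>) (\<rho> \<omega>) * walk_op h (E \<omega>) (\<lambda>_. 1) (\<rho> \<omega>)"
      unfolding walk_op_kernel nn_integral_count_space_linear .
  qed
  also have "\<dots> \<le> (\<integral>\<^sup>+\<omega>. g (E \<omega>) (\<rho> \<omega>) * 1 \<partial>M)"
    by (intro nn_integral_mono mult_left_mono step_graph.walk_op_1_le graph) auto
  finally show ?thesis by simp
qed

lemma local_fun_walk_op:
  assumes "local_fun 1 (\<lambda>E rs. g E (rs ! 0))"
  shows "local_fun 1 (\<lambda>E rs. walk_op h E (g E) (rs ! 0))"
proof -
  have g: "local_fun k (\<lambda>E rs. g E (rs ! i))" if "i < k" for i k
    using local_fun_reindex[of "[i]" "\<lambda>E rs. g E (rs ! 0)" k] assms that by simp
  have q1: "local_fun 1 (\<lambda>E rs. quiet_weight h E {rs ! 0})"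
    using local_fun_quiet_weight[of "[0]" 1 h] by simp
  have q2: "local_fun 2 (\<lambda>E rs. ennreal h * quiet_weight h E {rs ! 0, rs ! 1})"
    using local_fun_comp[OF local_fun_quiet_weight[of "[0, 1]" 2 h], where F = "(*) (ennreal h)"] by auto
  have A: "local_fun 1 (\<lambda>E rs. quiet_weight h E {rs ! 0} * g E (rs ! 0))"
    by (rule local_fun_comp2[where F = "(*)"]) (rule q1, rule g, simp)
  let ?b = "\<lambda>E rs. ennreal h * quiet_weight h E {rs ! 0, rs ! 1} * g E (rs ! 1)"
  let ?B = "\<lambda>E rs. \<Sum>u\<in>E `` {rs ! 0}. ?b E (rs @ [u])"
  have "local_fun 2 ?b" by (rule local_fun_comp2[where F = "(*)"]) (rule q2, rule g, simp)
  then have "local_fun (Suc 1) ?b" by (simp only: Suc_1)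
  then have B: "local_fun 1 ?B" by (rule local_fun_sum_nbrs) simp
  have "local_fun 1 (\<lambda>E rs. quiet_weight h E {rs ! 0} * g E (rs ! 0) + ?B E rs)"
    by (rule local_fun_comp2[where F = "(+)", OF A B])
  moreover have "local_fun 1 (\<lambda>E rs. quiet_weight h E {rs ! 0} * g E (rs ! 0) + ?B E rs) \<longleftrightarrow>
      local_fun 1 (\<lambda>E rs. walk_op h E (g E) (rs ! 0))"
    by (rule local_fun_cong) (simp add: nth_append walk_op_def)
  ultimately show ?thesis by (simp only:)
qed

lemma walk_op_neq_top: "(\<And>x. f x \<noteq> \<top>) \<Longrightarrow> walk_op h E f x \<noteq> \<top>"
  by (simp add: walk_op_def ennreal_mult_eq_top_iff quiet_weight_neq_top sum_neq_top)

text \<open>The outermost operator is removed first, with the remaining iterate in the role of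
  \<open>g\<close>; locality and finiteness of all iterates are therefore carried along.\<close>

lemma nn_integral_walk_op_iter_root_le:
  fixes g :: "(nat \<times> nat) set \<Rightarrow> nat \<Rightarrow> ennreal"
  assumes M: "random_rooted_graph M V E \<rho>" "unimodular M V E \<rho>" and h: "0 \<le> h"
    and g: "local_fun 1 (\<lambda>E rs. g E (rs ! 0))" "\<And>E x. g E x \<noteq> \<top>"
  shows "(\<integral>\<^sup>+\<omega>. (walk_op h (E \<omega>) ^^ k) (g (E \<omega>)) (\<rho> \<omega>) \<partial>M) \<le> (\<integral>\<^sup>+\<omega>. g (E \<omega>) (\<rho> \<omega>) \<partial>M)"
    and "local_fun 1 (\<lambda>E rs. (walk_op h E ^^ k) (g E) (rs ! 0))"
proof -
  have *: "local_fun 1 (\<lambda>E rs. (walk_op h E ^^ k) (g E) (rs ! 0))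
      \<and> (\<forall>E x. (walk_op h E ^^ k) (g E) x \<noteq> \<top>)" for k
  proof (induction k)
    case 0
    then show ?case using g by simp
  next
    case (Suc k)
    then show ?case
      using local_fun_walk_op[where g = "\<lambda>E. (walk_op h E ^^ k) (g E)" and h = h] by (auto simp: walk_op_neq_top)
  qed
  then show "local_fun 1 (\<lambda>E rs. (walk_op h E ^^ k) (g E) (rs ! 0))" by simp
  show "(\<integral>\<^sup>+\<omega>. (walk_op h (E \<omega>) ^^ k) (g (E \<omega>)) (\<rho> \<omega>) \<partial>M) \<le> (\<integral>\<^sup>+\<omega>. g (E \<omega>) (\<rho> \<omega>) \<partial>M)"
  proof (induction k)
    case (Suc k)
    have "(\<integral>\<^sup>+\<omega>. (walk_op h (E \<omega>) ^^ Suc k) (g (E \<omega>)) (\<rho> \<omega>) \<partial>M) \<le>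
        (\<integral>\<^sup>+\<omega>. (walk_op h (E \<omega>) ^^ k) (g (E \<omega>)) (\<rho> \<omega>) \<partial>M)"
      using nn_integral_walk_op_root_le[OF M h, of "\<lambda>E. (walk_op h E ^^ k) (g E)"] *[of k] by simp
    with Suc.IH show ?case by (rule order_trans[rotated])
  qed simp
qed

section \<open>The pair chain driven by independent counts\<close>

text \<open>\<open>c (e, i)\<close> stands for the number of rings of the clock \<open>e\<close>
  during step \<open>i\<close>; two rings of the same clock also violate the condition.\<close>

definition only_rings ::
  "(nat \<times> nat) set \<Rightarrow> ((nat \<times> nat) \<times> nat \<Rightarrow> nat) \<Rightarrow> nat \<Rightarrow> nat set \<Rightarrow> (nat \<times> nat) set \<Rightarrow> bool" where
  "only_rings E c i W Y \<longleftrightarrow> (\<forall>e\<in>out_edges E W. c (e, i) = of_bool (e \<in> Y))"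

text \<open>The recursion of \<open>pair_prob\<close> with each weight replaced by the indicator of
  the event whose probability it is; \<open>i\<close> is the number of the current step.\<close>

primrec pair_run ::
  "(nat \<times> nat) set \<Rightarrow> ((nat \<times> nat) \<times> nat \<Rightarrow> nat) \<Rightarrow> nat \<Rightarrow> nat \<Rightarrow> nat \<Rightarrow> nat \<Rightarrow> nat \<Rightarrow> ennreal" where
  "pair_run E c z 0 = (\<lambda>i a b. if a = z \<and> b = z then 1 else 0)"
| "pair_run E c z (Suc n) = (\<lambda>i a b.
     of_bool (only_rings E c i {a, b} {}) * pair_run E c z n (Suc i) a b
     + (\<Sum>u\<in>E `` {a}. of_bool (only_rings E c i {a, b, u} {(a, u)}) *
          pair_run E c z n (Suc i) u (if a = b then u else b))
     + (if a = b then 0 else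
          \<Sum>v\<in>E `` {b}. of_bool (only_rings E c i {a, b, v} {(b, v)}) * pair_run E c z n (Suc i) a v))"

lemma only_rings_cong:
  "(\<And>e. e \<in> E \<Longrightarrow> c (e, i) = c' (e, i)) \<Longrightarrow> only_rings E c i W Y = only_rings E c' i W Y"
  by (simp add: only_rings_def out_edges_def)

text \<open>A run from step \<open>i\<close> on reads no earlier counts. This gives its independence
  of the past and allows the counts to be restricted to a product space.\<close>

lemma pair_run_cong:
  "(\<And>e j. e \<in> E \<Longrightarrow> i \<le> j \<Longrightarrow> c (e, j) = c' (e, j)) \<Longrightarrow>
   pair_run E c z n i a b = pair_run E c' z n i a b"
proof (induction n arbitrary: i a b)
  case (Suc n)
  have "only_rings E c i W Y = only_rings E c' i W Y" for W Y
    using Suc.prems by (intro only_rings_cong) simp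
  moreover have "pair_run E c z n (Suc i) u v = pair_run E c' z n (Suc i) u v" for u v
    using Suc.prems by (intro Suc.IH) simp
  ultimately show ?case by simp
qed simp

lemma (in prob_space) indep_var_nn_integral_mult:
  fixes F G :: "'a \<Rightarrow> ennreal"
  assumes "indep_var borel F borel G"
  shows "(\<integral>\<^sup>+w. F w * G w \<partial>M) = (\<integral>\<^sup>+w. F w \<partial>M) * (\<integral>\<^sup>+w. G w \<partial>M)"
proof -
  have "case_bool borel borel = (\<lambda>_. borel :: ennreal measure)"
    by (auto split: bool.split)
  then have "indep_vars (\<lambda>_. borel) (case_bool F G) UNIV"
    using assms by (simp add: indep_var_def)
  from indep_vars_nn_integral[OF _ this] show ?thesis
    by (simp add: UNIV_bool mult.commute)
qed

text \<open>\<open>X (e, i)\<close> has the law of the number of rings of \<open>e\<close> in step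
  \<open>i\<close>, as far as it matters: two or more rings of a relevant clock kill the
  pair.\<close>

locale poisson_steps = step_graph h E + prob_space N
  for h :: real and E :: "(nat \<times> nat) set" and N :: "'w measure" +
  fixes X :: "(nat \<times> nat) \<times> nat \<Rightarrow> 'w \<Rightarrow> nat"
  assumes indep: "indep_vars (\<lambda>_. count_space UNIV) X (E \<times> UNIV)"
    and prob_0: "\<And>e i. e \<in> E \<Longrightarrow> prob {w \<in> space N. X (e, i) w = 0} = exp (- h)"
    and prob_1: "\<And>e i. e \<in> E \<Longrightarrow> prob {w \<in> space N. X (e, i) w = 1} = h * exp (- h)"
begin

lemma measurable_X [measurable]: "e \<in> E \<Longrightarrow> X (e, i) \<in> N \<rightarrow>\<^sub>M count_space UNIV"
  using indep by (auto simp: indep_vars_def)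

text \<open>By independence the probability is a product over the clocks, with factor
  \<open>h * exp (- h)\<close> on \<open>Y\<close> and \<open>exp (- h)\<close> elsewhere.\<close>

lemma nn_integral_only_rings:
  assumes "finite W"
  shows "(\<integral>\<^sup>+w. of_bool (only_rings E (\<lambda>p. X p w) i W Y) \<partial>N) =
    ennreal (h ^ card (out_edges E W \<inter> Y)) * quiet_weight h E W"
proof -
  let ?O = "out_edges E W"
  have fin: "finite ?O" using finite_out_edges[OF finite_nbrs assms] .
  have OE: "e \<in> E" if "e \<in> ?O" for e using that by (simp add: out_edges_def)
  let ?A = "\<lambda>e. {w \<in> space N. X (e, i) w = of_bool (e \<in> Y)}"
  let ?S = "{w \<in> space N. only_rings E (\<lambda>p. X p w) i W Y}"
  have "prob ?S = (\<Prod>e\<in>?O. prob (?A e))"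
  proof (cases "?O = {}")
    case True
    then show ?thesis by (simp add: only_rings_def prob_space)
  next
    case False
    have "prob (\<Inter>p\<in>?O \<times> {i}. X p -` {of_bool (fst p \<in> Y)} \<inter> space N) =
        (\<Prod>p\<in>?O \<times> {i}. prob (X p -` {of_bool (fst p \<in> Y)} \<inter> space N))"
      using False fin OE by (intro indep_varsD[OF indep]) auto
    moreover have "(\<Inter>p\<in>?O \<times> {i}. X p -` {of_bool (fst p \<in> Y)} \<inter> space N) = ?S"
      using False by (auto simp: only_rings_def)
    moreover have "(\<Prod>p\<in>?O \<times> {i}. prob (X p -` {of_bool (fst p \<in> Y)} \<inter> space N)) = (\<Prod>e\<in>?O. prob (?A e))"
      by (rule prod.reindex_cong[where l = "\<lambda>e. (e, i)"])
        (auto simp: inj_on_def intro!: arg_cong[where f = prob])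
    ultimately show ?thesis by simp
  qed
  also have "\<dots> = (\<Prod>e\<in>?O. (if e \<in> Y then h else 1) * exp (- h))"
    using prob_0 prob_1 OE by (intro prod.cong) auto
  also have "\<dots> = h ^ card (?O \<inter> Y) * exp (- h * real (card ?O))"
    using fin by (simp add: prod.distrib prod.If_cases exp_of_nat_mult[symmetric] mult.commute)
  finally have P: "prob ?S = h ^ card (?O \<inter> Y) * exp (- h * real (card ?O))" .
  have [measurable]: "?S \<in> sets N"
  proof -
    have "?S = {w \<in> space N. \<forall>e\<in>?O. X (e, i) w = of_bool (e \<in> Y)}" by (simp add: only_rings_def)
    also have "\<dots> \<in> sets N" using fin OE by (intro sets.sets_Collect_finite_All) measurable
    finally show ?thesis .
  qed
  have "(\<integral>\<^sup>+w. of_bool (only_rings E (\<lambda>p. X p w) i W Y) \<partial>N) = (\<integral>\<^sup>+w. indicator ?S w \<partial>N)"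
    by (intro nn_integral_cong) (simp add: indicator_def)
  also have "\<dots> = ennreal (prob ?S)" by (simp add: emeasure_eq_measure)
  finally show ?thesis
    using h_nonneg by (simp add: P quiet_weight_def ennreal_mult)
qed

lemma measurable_only_rings:
  assumes "finite W" "E \<times> {i} \<subseteq> I"
  shows "(\<lambda>c. of_bool (only_rings E c i W Y) :: ennreal) \<in> borel_measurable (PiM I (\<lambda>_. count_space UNIV))"
proof -
  have fin: "finite (out_edges E W)" using finite_out_edges[OF finite_nbrs assms(1)] .
  have "(\<lambda>c. c (e, i)) \<in> PiM I (\<lambda>_. count_space UNIV) \<rightarrow>\<^sub>M count_space UNIV"
    if "e \<in> out_edges E W" for e
    using that assms(2) by (intro measurable_component_singleton) (auto simp: out_edges_def)
  then have P: "Measurable.pred (PiM I (\<lambda>_. count_space UNIV)) (\<lambda>c. c (e, i) = of_bool (e \<in> Y))"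
    if "e \<in> out_edges E W" for e
    using that by measurable
  have "Measurable.pred (PiM I (\<lambda>_. count_space UNIV)) (\<lambda>c. only_rings E c i W Y)"
    unfolding only_rings_def by (intro pred_intros_finite fin P)
  then show ?thesis unfolding of_bool_def by measurable
qed

lemma measurable_pair_run:
  "E \<times> {i..} \<subseteq> I \<Longrightarrow>
   (\<lambda>c. pair_run E c z n i a b) \<in> borel_measurable (PiM I (\<lambda>_. count_space UNIV))"
proof (induction n arbitrary: i a b)
  case (Suc n)
  have "(\<lambda>c. pair_run E c z n (Suc i) u v) \<in> borel_measurable (PiM I (\<lambda>_. count_space UNIV))" for u v
    using Suc.prems by (intro Suc.IH) force
  moreover have "(\<lambda>c. of_bool (only_rings E c i W Y) :: ennreal) \<in> borel_measurable (PiM I (\<lambda>_. count_space UNIV))"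
    if "finite W" for W Y
    using Suc.prems that by (intro measurable_only_rings) force+
  ultimately show ?case
    unfolding pair_run.simps by (cases "a = b") (simp_all add: borel_measurable_sum)
qed simp

lemma measurable_pair_run_X: "(\<lambda>w. pair_run E (\<lambda>p. X p w) z n i a b) \<in> borel_measurable N"
proof -
  let ?I = "E \<times> {i..}"
  have "(\<lambda>w. restrict (\<lambda>p. X p w) ?I) \<in> N \<rightarrow>\<^sub>M PiM ?I (\<lambda>_. count_space UNIV)"
    by (intro measurable_restrict) auto
  from measurable_compose[OF this measurable_pair_run[OF order_refl]]
  have "(\<lambda>w. pair_run E (restrict (\<lambda>p. X p w) ?I) z n i a b) \<in> borel_measurable N" .
  moreover have "pair_run E (restrict (\<lambda>p. X p w) ?I) z n i a b = pair_run E (\<lambda>p. X p w) z n i a b" for w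
    by (rule pair_run_cong) simp
  ultimately show ?thesis by simp
qed

text \<open>Step \<open>i\<close> and the later steps depend on disjoint families of counts.\<close>

lemma nn_integral_only_rings_mult:
  assumes "finite W"
  shows "(\<integral>\<^sup>+w. of_bool (only_rings E (\<lambda>p. X p w) i W Y) * pair_run E (\<lambda>p. X p w) z n (Suc i) a b \<partial>N) =
    ennreal (h ^ card (out_edges E W \<inter> Y)) * quiet_weight h E W *
    (\<integral>\<^sup>+w. pair_run E (\<lambda>p. X p w) z n (Suc i) a b \<partial>N)"
proof -
  let ?A = "E \<times> {i}" and ?B = "E \<times> {Suc i..}"
  let ?f = "\<lambda>c. of_bool (only_rings E c i W Y) :: ennreal"
  let ?g = "\<lambda>c. pair_run E c z n (Suc i) a b"
  have "indep_var (PiM ?A (\<lambda>_. count_space UNIV)) (\<lambda>w. restrict (\<lambda>p. X p w) ?A)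
      (PiM ?B (\<lambda>_. count_space UNIV)) (\<lambda>w. restrict (\<lambda>p. X p w) ?B)"
    by (rule indep_var_restrict[OF indep]) auto
  from indep_var_compose[OF this measurable_only_rings[OF assms order_refl] measurable_pair_run[OF order_refl]]
  have "indep_var borel (?f \<circ> (\<lambda>w. restrict (\<lambda>p. X p w) ?A)) borel (?g \<circ> (\<lambda>w. restrict (\<lambda>p. X p w) ?B))" .
  moreover have "?f \<circ> (\<lambda>w. restrict (\<lambda>p. X p w) ?A) = (\<lambda>w. ?f (\<lambda>p. X p w))"
  proof
    fix w
    have "only_rings E (restrict (\<lambda>p. X p w) ?A) i W Y = only_rings E (\<lambda>p. X p w) i W Y"
      by (rule only_rings_cong) simp
    then show "(?f \<circ> (\<lambda>w. restrict (\<lambda>p. X p w) ?A)) w = ?f (\<lambda>p. X p w)" by simp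
  qed
  moreover have "?g \<circ> (\<lambda>w. restrict (\<lambda>p. X p w) ?B) = (\<lambda>w. ?g (\<lambda>p. X p w))"
    unfolding comp_def by (intro ext pair_run_cong) simp
  ultimately have "indep_var borel (\<lambda>w. ?f (\<lambda>p. X p w)) borel (\<lambda>w. ?g (\<lambda>p. X p w))" by (simp only:)
  from indep_var_nn_integral_mult[OF this] show ?thesis
    by (simp only: nn_integral_only_rings[OF assms])
qed

lemma measurable_step [measurable]:
  assumes "finite W"
  shows "(\<lambda>w. of_bool (only_rings E (\<lambda>p. X p w) i W Y) * pair_run E (\<lambda>p. X p w) z n (Suc i) a b)
    \<in> borel_measurable N"
proof -
  let ?I = "E \<times> {i}"
  have "(\<lambda>w. restrict (\<lambda>p. X p w) ?I) \<in> N \<rightarrow>\<^sub>M PiM ?I (\<lambda>_. count_space UNIV)"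
    by (intro measurable_restrict) auto
  from measurable_compose[OF this measurable_only_rings[OF assms order_refl]]
  have "(\<lambda>w. of_bool (only_rings E (restrict (\<lambda>p. X p w) ?I) i W Y) :: ennreal) \<in> borel_measurable N" .
  moreover have "only_rings E (restrict (\<lambda>p. X p w) ?I) i W Y = only_rings E (\<lambda>p. X p w) i W Y" for w
    by (rule only_rings_cong) simp
  ultimately have "(\<lambda>w. of_bool (only_rings E (\<lambda>p. X p w) i W Y) :: ennreal) \<in> borel_measurable N" by simp
  then show ?thesis by (rule borel_measurable_times_ennreal) (rule measurable_pair_run_X)
qed

text \<open>Splitting off step \<open>i\<close> by independence reproduces the recursion of
  \<open>pair_prob\<close>; the result is the same for every \<open>i\<close> because all steps have
  the same law.\<close>

lemma nn_integral_pair_run: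
  "(\<integral>\<^sup>+w. pair_run E (\<lambda>p. X p w) z n i a b \<partial>N) = pair_prob h E n z a b"
proof (induction n arbitrary: i a b)
  case 0
  then show ?case by (simp add: emeasure_space_1)
next
  case (Suc n)
  have 0: "(\<integral>\<^sup>+w. of_bool (only_rings E (\<lambda>p. X p w) i {a, b} {}) * pair_run E (\<lambda>p. X p w) z n (Suc i) a b \<partial>N) =
      quiet_weight h E {a, b} * pair_prob h E n z a b"
    by (subst nn_integral_only_rings_mult) (simp_all add: Suc.IH)
  have 1: "(\<integral>\<^sup>+w. of_bool (only_rings E (\<lambda>p. X p w) i W {e}) * pair_run E (\<lambda>p. X p w) z n (Suc i) u v \<partial>N) =
      ennreal h * quiet_weight h E W * pair_prob h E n z u v"
    if "finite W" "e \<in> E" "fst e \<in> W" for W e u v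
  proof -
    have "out_edges E W \<inter> {e} = {e}" using that by (auto simp: out_edges_def mem_Times_iff)
    then show ?thesis by (subst nn_integral_only_rings_mult[OF that(1)]) (simp add: Suc.IH)
  qed
  have "(\<integral>\<^sup>+w. (\<Sum>u\<in>E `` {a}. of_bool (only_rings E (\<lambda>p. X p w) i {a, b, u} {(a, u)}) *
          pair_run E (\<lambda>p. X p w) z n (Suc i) u (if a = b then u else b)) \<partial>N) =
      (\<Sum>u\<in>E `` {a}. ennreal h * quiet_weight h E {a, b, u} * pair_prob h E n z u (if a = b then u else b))"
    by (subst nn_integral_sum) (auto intro!: sum.cong 1 measurable_step)
  moreover have "(\<integral>\<^sup>+w. (if a = b then 0 else \<Sum>v\<in>E `` {b}. of_bool (only_rings E (\<lambda>p. X p w) i {a, b, v} {(b, v)}) *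
          pair_run E (\<lambda>p. X p w) z n (Suc i) a v) \<partial>N) =
      (if a = b then 0 else \<Sum>v\<in>E `` {b}. ennreal h * quiet_weight h E {a, b, v} * pair_prob h E n z a v)"
  proof (cases "a = b")
    case False
    then show ?thesis unfolding if_not_P[OF False]
      by (subst nn_integral_sum) (auto intro!: sum.cong 1 measurable_step)
  qed simp
  ultimately show ?case
    unfolding pair_run.simps pair_prob.simps 0[symmetric]
    by (subst nn_integral_add, simp_all add: nn_integral_add measurable_step)
qed

end

section \<open>Counts of Poisson clocks\<close>

lemma space_configuration_space [simp]: "space configuration_space = locally_finite_sets"
  unfolding configuration_space_def by (rule space_measure_of) auto

lemma measurable_card_Int:
  assumes "A \<in> sets borel" "bounded A"
  shows "(\<lambda>S. card (S \<inter> A)) \<in> configuration_space \<rightarrow>\<^sub>M count_space UNIV"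
proof (subst measurable_count_space_eq2_countable, intro conjI ballI)
  fix n :: nat
  have "{S \<in> locally_finite_sets. card (S \<inter> A) = n} \<in> sets configuration_space"
    unfolding configuration_space_def using assms
    by (subst sets_measure_of) (auto intro!: sigma_sets.Basic)
  moreover have "(\<lambda>S. card (S \<inter> A)) -` {n} \<inter> space configuration_space =
      {S \<in> locally_finite_sets. card (S \<inter> A) = n}" by auto
  ultimately show "(\<lambda>S. card (S \<inter> A)) -` {n} \<inter> space configuration_space \<in> sets configuration_space"
    by simp
qed auto

lemma poisson_clocks_measurable:
  assumes "poisson_clocks E N U" "e \<in> E"
  shows "U e \<in> N \<rightarrow>\<^sub>M configuration_space"
proof -
  have "unit_poisson_process N (U e)" using assms by (simp add: poisson_clocks_def)
  then show ?thesis unfolding unit_poisson_process_def by (elim conjE)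
qed

lemma poisson_clocks_prob:
  assumes "poisson_clocks E N U" "e \<in> E" "A \<in> sets borel" "bounded A" "A \<subseteq> {0..}"
  shows "measure N {w \<in> space N. card (U e w \<inter> A) = n} =
    exp (- measure lborel A) * measure lborel A ^ n / fact n"
proof -
  have "unit_poisson_process N (U e)" using assms by (simp add: poisson_clocks_def)
  then show ?thesis unfolding unit_poisson_process_def using assms(3-5) by simp
qed

lemma poisson_clocks_locally_finite:
  assumes "poisson_clocks E N U" "e \<in> E" "w \<in> space N"
  shows "U e w \<subseteq> {0..}" "finite (U e w \<inter> {0..b})"
proof -
  have "U e w \<in> space configuration_space"
    by (rule measurable_space[OF poisson_clocks_measurable[OF assms(1,2)] assms(3)])
  then show "U e w \<subseteq> {0..}" "finite (U e w \<inter> {0..b})" by (auto simp: locally_finite_sets_def)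
qed

text \<open>Two kinds of independence are combined: that of whole clocks over different edges, and
  that of the counts of one clock over disjoint sets. A finite index set is split into its fibres
  over the edges.\<close>

lemma poisson_clocks_indep_counts:
  fixes I :: "nat \<Rightarrow> real set"
  assumes clocks: "poisson_clocks E N U"
    and I: "\<And>i. I i \<in> sets borel" "\<And>i. bounded (I i)" "\<And>i. I i \<subseteq> {0..}" "disjoint_family I"
  shows "prob_space.indep_vars N (\<lambda>_. count_space UNIV)
    (\<lambda>p w. card (U (fst p) w \<inter> I (snd p))) (E \<times> UNIV)"
proof -
  interpret prob_space N using clocks by (simp add: poisson_clocks_def)
  note U = poisson_clocks_measurable[OF clocks]
  have indep_E: "indep_vars (\<lambda>_. configuration_space) U E"
    using clocks by (simp add: poisson_clocks_def)
  have indep_I: "indep_vars (\<lambda>_. count_space UNIV) (\<lambda>i w. card (U e w \<inter> I i)) UNIV" if "e \<in> E" for e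
  proof -
    have "unit_poisson_process N (U e)" using clocks that by (simp add: poisson_clocks_def)
    then show ?thesis unfolding unit_poisson_process_def using I by simp
  qed
  have meas: "(\<lambda>w. card (U e w \<inter> I i)) \<in> N \<rightarrow>\<^sub>M count_space UNIV" if "e \<in> E" for e i
    using measurable_compose[OF U[OF that] measurable_card_Int[OF I(1,2)]] .
  let ?X = "\<lambda>p w. card (U (fst p) w \<inter> I (snd p))"
  show ?thesis unfolding indep_vars_def2
  proof (intro conjI ballI indep_setsI)
    fix p assume "p \<in> E \<times> (UNIV :: nat set)"
    then show "?X p \<in> N \<rightarrow>\<^sub>M count_space UNIV" using meas by auto
  next
    fix p assume "p \<in> E \<times> (UNIV :: nat set)"
    then show "{?X p -` A \<inter> space N |A. A \<in> sets (count_space UNIV)} \<subseteq> events"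
      using meas by (auto intro!: measurable_sets[OF meas])
  next
    fix A J
    assume J: "J \<noteq> {}" "J \<subseteq> E \<times> (UNIV :: nat set)" "finite J"
      and A: "\<forall>p\<in>J. A p \<in> {?X p -` A \<inter> space N |A. A \<in> sets (count_space UNIV)}"
    from A have "\<forall>p\<in>J. \<exists>B. A p = ?X p -` B \<inter> space N" by blast
    then obtain B where B: "\<And>p. p \<in> J \<Longrightarrow> A p = ?X p -` B p \<inter> space N" by metis
    define K where "K = fst ` J"
    define L where "L e = {i. (e, i) \<in> J}" for e
    \<comment> \<open>All conditions on the clock of \<open>e\<close> are gathered into one event in
      configuration space, to which independence of the clocks applies.\<close>
    define G where "G e = {S \<in> space configuration_space. \<forall>i\<in>L e. card (S \<inter> I i) \<in> B (e, i)}" for e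
    have K: "finite K" "K \<noteq> {}" "K \<subseteq> E" using J by (auto simp: K_def)
    have L: "finite (L e)" for e
    proof -
      have "L e \<subseteq> snd ` J" by (force simp: L_def)
      then show ?thesis using J(3) finite_subset by blast
    qed
    have L_ne: "L e \<noteq> {}" if "e \<in> K" for e using that by (auto simp: K_def L_def)
    have J_eq: "J = Sigma K L" by (force simp: K_def L_def)
    have G_sets: "G e \<in> sets configuration_space" for e
      unfolding G_def
    proof (rule sets.sets_Collect_finite_All[OF _ L])
      fix i
      have "(\<lambda>S. card (S \<inter> I i)) -` B (e, i) \<inter> space configuration_space \<in> sets configuration_space"
        using measurable_card_Int[OF I(1,2)] by (rule measurable_sets) simp
      moreover have "(\<lambda>S. card (S \<inter> I i)) -` B (e, i) \<inter> space configuration_space =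
          {S \<in> space configuration_space. card (S \<inter> I i) \<in> B (e, i)}" by auto
      ultimately show "{S \<in> space configuration_space. card (S \<inter> I i) \<in> B (e, i)} \<in> sets configuration_space"
        by simp
    qed
    have G_eq: "U e -` G e \<inter> space N = (\<Inter>i\<in>L e. A (e, i))" if "e \<in> K" for e
    proof -
      have "U e w \<in> space configuration_space" if "w \<in> space N" for w
        using measurable_space[OF U that] \<open>e \<in> K\<close> K(3) by blast
      then show ?thesis using L_ne[OF that] that B by (auto simp: G_def L_def)
    qed
    have "prob (\<Inter>p\<in>J. A p) = prob (\<Inter>e\<in>K. U e -` G e \<inter> space N)"
      unfolding J_eq using G_eq by (intro arg_cong[where f = prob]) auto
    also have "\<dots> = (\<Prod>e\<in>K. prob (U e -` G e \<inter> space N))"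
      using K G_sets by (intro indep_varsD[OF indep_E]) auto
    also have "\<dots> = (\<Prod>e\<in>K. \<Prod>i\<in>L e. prob (A (e, i)))"
    proof (rule prod.cong[OF refl])
      fix e assume e: "e \<in> K"
      have Ae: "A (e, i) = (\<lambda>w. card (U e w \<inter> I i)) -` B (e, i) \<inter> space N" if "i \<in> L e" for i
        using B that by (simp add: L_def)
      have "prob (\<Inter>i\<in>L e. A (e, i)) = prob (\<Inter>i\<in>L e. (\<lambda>w. card (U e w \<inter> I i)) -` B (e, i) \<inter> space N)"
        using Ae by simp
      also have "\<dots> = (\<Prod>i\<in>L e. prob ((\<lambda>w. card (U e w \<inter> I i)) -` B (e, i) \<inter> space N))"
        using e K(3) L L_ne by (intro indep_varsD[OF indep_I]) auto
      also have "\<dots> = (\<Prod>i\<in>L e. prob (A (e, i)))" using Ae by simp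
      finally show "prob (U e -` G e \<inter> space N) = (\<Prod>i\<in>L e. prob (A (e, i)))"
        using G_eq[OF e] by simp
    qed
    also have "\<dots> = (\<Prod>p\<in>J. prob (A p))"
      unfolding J_eq using K L by (subst prod.Sigma) auto
    finally show "prob (\<Inter>p\<in>J. A p) = (\<Prod>p\<in>J. prob (A p))" .
  qed
qed

text \<open>Open on the left, because \<open>next_jump\<close> looks at strictly later times: a ring
  at the end of a step belongs to that step.\<close>

definition step_interval :: "real \<Rightarrow> real \<Rightarrow> nat \<Rightarrow> real set" where
  "step_interval s h i = {s + real i * h<..s + real (Suc i) * h}"

lemma step_interval_subset:
  assumes "0 \<le> h"
  shows "step_interval s h i \<subseteq> {s<..}"
proof -
  have "0 \<le> real i * h" using assms by simp
  then show ?thesis by (auto simp: step_interval_def)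
qed

lemma measure_step_interval: "0 \<le> h \<Longrightarrow> measure lborel (step_interval s h i) = h"
  by (simp add: step_interval_def algebra_simps)

lemma disjoint_step_interval:
  assumes "0 \<le> h"
  shows "disjoint_family (step_interval s h)"
proof -
  have "step_interval s h i \<inter> step_interval s h j = {}" if "i < j" for i j
  proof -
    have "real (Suc i) * h \<le> real j * h" using that assms by (intro mult_right_mono) auto
    then show ?thesis by (auto simp: step_interval_def)
  qed
  then show ?thesis unfolding disjoint_family_on_def by (metis Int_commute linorder_neqE_nat)
qed

lemma poisson_clocks_steps:
  assumes clocks: "poisson_clocks E N U" and graph: "step_graph h E" and s: "0 \<le> s"
  shows "poisson_steps h E N (\<lambda>p w. card (U (fst p) w \<inter> step_interval s h (snd p)))"
proof -
  interpret step_graph h E by (rule graph)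
  interpret prob_space N using clocks by (simp add: poisson_clocks_def)
  let ?I = "step_interval s h"
  have I: "?I i \<in> sets borel" "bounded (?I i)" "?I i \<subseteq> {0..}" for i
    using s h_nonneg step_interval_subset[of h s i] by (auto simp: step_interval_def)
  note measure_step_interval[OF h_nonneg]
  then have P: "prob {w \<in> space N. card (U e w \<inter> ?I i) = n} = exp (- h) * h ^ n / fact n" if "e \<in> E" for e i n
    using poisson_clocks_prob[OF clocks that I] by simp
  show ?thesis
  proof
    show "indep_vars (\<lambda>_. count_space UNIV) (\<lambda>p w. card (U (fst p) w \<inter> ?I (snd p))) (E \<times> UNIV)"
      by (rule poisson_clocks_indep_counts[OF clocks I disjoint_step_interval[OF h_nonneg]])
  qed (simp_all add: P)
qed

text \<open>Cut the time up to \<open>b\<close> into \<open>n + 1\<close> intervals. Both clocks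
  ring in a given one with probability at most \<open>(b / (n + 1))\<^sup>2\<close>, hence in some
  common one with probability at most \<open>b\<^sup>2 / (n + 1)\<close>, which tends to 0; a common
  ring lies in such an interval for every \<open>n\<close>.\<close>

lemma poisson_clocks_disjoint_AE:
  assumes clocks: "poisson_clocks E N U" and e: "e \<in> E" "e' \<in> E" "e \<noteq> e'"
  shows "AE w in N. U e w \<inter> U e' w \<inter> {0<..} = {}"
proof -
  interpret prob_space N using clocks by (simp add: poisson_clocks_def)
  have "AE w in N. U e w \<inter> U e' w \<inter> {0<..real b} = {}" for b :: nat
  proof -
    define I where "I n = step_interval 0 (real b / real (Suc n))" for n
    define A where "A n i = {w \<in> space N. card (U e w \<inter> I n i) \<noteq> 0 \<and> card (U e' w \<inter> I n i) \<noteq> 0}" for n i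
    have A: "A n i \<in> events \<and> prob (A n i) \<le> (real b / real (Suc n))\<^sup>2" for n i
    proof -
      let ?h = "real b / real (Suc n)"
      have I: "I n i \<in> sets borel" "bounded (I n i)" "I n i \<subseteq> {0..}" for i
        using step_interval_subset[of ?h 0 i] by (auto simp: I_def step_interval_def)
      let ?X = "\<lambda>p w. card (U (fst p) w \<inter> I n (snd p))"
      have ind: "indep_vars (\<lambda>_. count_space UNIV) ?X (E \<times> UNIV)"
        using disjoint_step_interval[of ?h 0] by (intro poisson_clocks_indep_counts[OF clocks I]) (simp add: I_def)
      then have X: "?X p \<in> N \<rightarrow>\<^sub>M count_space UNIV" if "p \<in> E \<times> UNIV" for p
        using that unfolding indep_vars_def by blast
      have A_eq: "A n i = (\<Inter>p\<in>{(e, i), (e', i)}. ?X p -` (- {0}) \<inter> space N)"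
        by (auto simp: A_def)
      have "prob (A n i) = (\<Prod>p\<in>{(e, i), (e', i)}. prob (?X p -` (- {0}) \<inter> space N))"
        unfolding A_eq using e by (intro indep_varsD[OF ind]) auto
      also have "\<dots> = prob (?X (e, i) -` (- {0}) \<inter> space N) * prob (?X (e', i) -` (- {0}) \<inter> space N)"
        using e by simp
      also have "\<dots> \<le> ?h * ?h"
      proof -
        have "prob (?X (f, i) -` (- {0}) \<inter> space N) \<le> ?h" if f: "f \<in> E" for f
        proof -
          have "measure lborel (I n i) = ?h"
            by (simp only: I_def measure_step_interval of_nat_0_le_iff divide_nonneg_nonneg)
          moreover have "prob {w \<in> space N. card (U f w \<inter> I n i) = 0} =
              exp (- measure lborel (I n i)) * measure lborel (I n i) ^ 0 / fact 0"
            by (rule poisson_clocks_prob[OF clocks f I])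
          moreover have "?X (f, i) -` (- {0}) \<inter> space N = space N - {w \<in> space N. card (U f w \<inter> I n i) = 0}"
            by auto
          moreover have "{w \<in> space N. card (U f w \<inter> I n i) = 0} \<in> events"
            using measurable_sets[OF X, of "(f, i)" "{0}"] f by (simp add: vimage_def Int_def conj_commute)
          ultimately have "prob (?X (f, i) -` (- {0}) \<inter> space N) = 1 - exp (- ?h)"
            by (simp add: prob_compl)
          then show ?thesis using exp_ge_add_one_self[of "- ?h"] by linarith
        qed
        then show ?thesis using e by (intro mult_mono) auto
      qed
      finally have "prob (A n i) \<le> ?h\<^sup>2" by (simp add: power2_eq_square)
      moreover have "A n i \<in> events"
        unfolding A_eq using e by (intro sets.finite_INT measurable_sets[OF X]) auto
      ultimately show ?thesis by simp
    qed
    define C where "C n = (\<Union>i\<le>n. A n i)" for n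
    have C: "C n \<in> events" "prob (C n) \<le> (real b)\<^sup>2 / real (Suc n)" for n
    proof -
      show "C n \<in> events" unfolding C_def using A by auto
      have "prob (C n) \<le> (\<Sum>i\<le>n. prob (A n i))"
        unfolding C_def using A by (intro finite_measure_subadditive_finite) auto
      also have "\<dots> \<le> (\<Sum>i\<le>n. (real b / real (Suc n))\<^sup>2)" using A by (intro sum_mono) auto
      also have "\<dots> = (real b)\<^sup>2 / real (Suc n)" by (simp add: power_divide power2_eq_square)
      finally show "prob (C n) \<le> (real b)\<^sup>2 / real (Suc n)" .
    qed
    have "(\<Inter>n. C n) \<in> null_sets N"
    proof -
      have "prob (\<Inter>n. C n) \<le> (real b)\<^sup>2 / real (Suc n)" for n
        using finite_measure_mono[of "\<Inter>n. C n" "C n"] C[of n] by force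
      moreover have "(\<lambda>n. (real b)\<^sup>2 / real (Suc n)) \<longlonglongrightarrow> 0"
        using tendsto_mult_left[OF LIMSEQ_inverse_real_of_nat, of "(real b)\<^sup>2"]
        by (simp add: divide_inverse del: of_nat_Suc)
      ultimately have "prob (\<Inter>n. C n) \<le> 0" by (intro LIMSEQ_le_const) auto
      then show ?thesis using C(1) by (intro null_setsI) (auto simp: emeasure_eq_measure measure_le_0_iff)
    qed
    then show ?thesis
    proof (rule AE_I'[OF _ subsetI])
      fix w assume "w \<in> {w \<in> space N. \<not> U e w \<inter> U e' w \<inter> {0<..real b} = {}}"
      then obtain \<tau> where w: "w \<in> space N" and \<tau>: "\<tau> \<in> U e w" "\<tau> \<in> U e' w" "0 < \<tau>" "\<tau> \<le> real b" by auto
      have "w \<in> C n" for n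
      proof -
        let ?h = "real b / real (Suc n)"
        have h: "0 < ?h" using \<tau> by simp
        \<comment> \<open>The index with \<open>i * ?h < \<tau> \<le> (i + 1) * ?h\<close>; the
          subtraction on naturals is exact since the ceiling is positive.\<close>
        define i where "i = nat \<lceil>\<tau> / ?h\<rceil> - 1"
        have c: "0 < \<lceil>\<tau> / ?h\<rceil>" using \<tau> h by simp
        then have i: "real (Suc i) = of_int \<lceil>\<tau> / ?h\<rceil>" unfolding i_def by linarith
        then have "\<tau> / ?h \<le> real (Suc i)" "real i < \<tau> / ?h" by linarith+
        then have "\<tau> \<le> real (Suc i) * ?h" "real i * ?h < \<tau>"
          using h by (simp_all only: pos_divide_le_eq pos_less_divide_eq)
        then have \<tau>I: "\<tau> \<in> I n i" by (simp add: I_def step_interval_def)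
        have "real i * ?h < real (Suc n) * ?h" using \<open>real i * ?h < \<tau>\<close> \<tau>(4) by simp
        then have "i \<le> n" using h by (simp only: mult_less_cancel_right_pos of_nat_less_iff less_Suc_eq_le)
        moreover have "card (U f w \<inter> I n i) \<noteq> 0" if "f \<in> E" "\<tau> \<in> U f w" for f
        proof -
          \<comment> \<open>\<open>card\<close> is 0 on infinite sets, so a nonempty intersection
            alone would not do.\<close>
          have "U f w \<inter> I n i \<subseteq> U f w \<inter> {0..real (Suc i) * ?h}"
            using poisson_clocks_locally_finite(1)[OF clocks that(1) w] by (auto simp: I_def step_interval_def)
          then have "finite (U f w \<inter> I n i)"
            using poisson_clocks_locally_finite(2)[OF clocks that(1) w] finite_subset by blast
          then show ?thesis using that \<tau>I by auto
        qed
        then have "w \<in> A n i" using w \<tau>(1,2) e(1,2) by (simp add: A_def)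
        ultimately show ?thesis unfolding C_def by (intro UN_I[of i]) simp_all
      qed
      then show "w \<in> (\<Inter>n. C n)" by simp
    qed
  qed
  then have "AE w in N. \<forall>b::nat. U e w \<inter> U e' w \<inter> {0<..real b} = {}" by (simp add: AE_all_countable)
  then show ?thesis
  proof (eventually_elim, intro equals0I)
    fix w \<tau> assume *: "\<forall>b::nat. U e w \<inter> U e' w \<inter> {0<..real b} = {}" "\<tau> \<in> U e w \<inter> U e' w \<inter> {0<..}"
    obtain b :: nat where "\<tau> \<le> real b" using real_arch_simple[of \<tau>] ..
    then have "\<tau> \<in> U e w \<inter> U e' w \<inter> {0<..real b}" using *(2) by simp
    then show False using *(1) by (metis empty_iff)
  qed
qed

section \<open>Walks along a fixed realization of the clocks\<close>

text \<open>The almost sure properties of the clocks. Common rings are excluded at positive times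
  only, which suffices since all jumps occur strictly after
  \<open>s\<^sub>0 \<ge> 0\<close>.\<close>

locale clock_realization =
  fixes E :: "(nat \<times> nat) set" and U :: "nat \<times> nat \<Rightarrow> real set" and s\<^sub>0 :: real
  assumes finite_nbrs: "\<And>v. finite (E `` {v})"
    and finite_rings: "\<And>e b. e \<in> E \<Longrightarrow> finite (U e \<inter> {0..b})"
    and no_common_ring: "\<And>e e' \<tau>. e \<in> E \<Longrightarrow> e' \<in> E \<Longrightarrow> 0 < \<tau> \<Longrightarrow> \<tau> \<in> U e \<Longrightarrow> \<tau> \<in> U e' \<Longrightarrow> e = e'"
    and s0_nonneg: "0 \<le> s\<^sub>0"
begin

definition rings :: "nat \<Rightarrow> real \<Rightarrow> real set" where
  "rings a r = {t. r < t \<and> (\<exists>u. (a, u) \<in> E \<and> t \<in> U (a, u))}"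

lemma next_jump_eq:
  assumes "0 \<le> r" "(a, u) \<in> E" "\<tau> \<in> U (a, u)" "r < \<tau>" "\<And>t. t \<in> rings a r \<Longrightarrow> \<tau> \<le> t"
  shows "next_jump E U (a, r) = Some (u, \<tau>)"
proof -
  have \<tau>: "\<tau> \<in> rings a r" using assms by (auto simp: rings_def)
  then have Inf: "Inf (rings a r) = \<tau>" using assms(5) by (rule cInf_eq_minimum)
  have "(SOME u. (a, u) \<in> E \<and> \<tau> \<in> U (a, u)) = u"
  proof (rule some_equality)
    fix v assume "(a, v) \<in> E \<and> \<tau> \<in> U (a, v)"
    then show "v = u" using no_common_ring[of "(a, v)" "(a, u)" \<tau>] assms by simp
  qed (use assms in simp)
  moreover have "next_jump E U (a, r) = Some (SOME u. (a, u) \<in> E \<and> Inf (rings a r) \<in> U (a, u), Inf (rings a r))"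
    using \<tau> by (auto simp: next_jump_def rings_def[symmetric] Let_def)
  ultimately show ?thesis by (simp add: Inf)
qed

text \<open>Finitely many clocks with finitely many rings each up to a bounded time: the infimum in
  \<open>next_jump\<close> is a minimum.\<close>

lemma next_jumpE:
  assumes "0 \<le> r" "next_jump E U (a, r) = Some (y, r')"
  obtains "r < r'" "(a, y) \<in> E" "r' \<in> U (a, y)" "\<And>t. t \<in> rings a r \<Longrightarrow> r' \<le> t"
proof -
  have "rings a r \<noteq> {}"
    using assms(2) by (auto simp: next_jump_def rings_def[symmetric] Let_def split: if_splits)
  then obtain t0 where t0: "t0 \<in> rings a r" by auto
  let ?S = "{t \<in> rings a r. t \<le> t0}"
  have "?S \<subseteq> (\<Union>u\<in>E `` {a}. U (a, u) \<inter> {0..t0})" using assms(1) by (auto simp: rings_def)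
  moreover have "finite (\<Union>u\<in>E `` {a}. U (a, u) \<inter> {0..t0})"
    by (intro finite_UN_I finite_nbrs finite_rings) simp
  ultimately have fin: "finite ?S" by (rule finite_subset)
  have ne: "?S \<noteq> {}" using t0 by auto
  define m where "m = Min ?S"
  have "m \<in> ?S" unfolding m_def by (rule Min_in[OF fin ne])
  then have m: "m \<in> rings a r" "m \<le> t0" by auto
  have min: "m \<le> t" if "t \<in> rings a r" for t
    using that m(2) Min_le[OF fin, of t] by (cases "t \<le> t0") (auto simp: m_def)
  obtain u where u: "(a, u) \<in> E" "m \<in> U (a, u)" "r < m" using m(1) by (auto simp: rings_def)
  have "next_jump E U (a, r) = Some (u, m)" by (rule next_jump_eq[OF assms(1) u min])
  then have "y = u" "r' = m" using assms(2) by auto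
  then show thesis using that u min by simp
qed

abbreviation walk :: "nat \<Rightarrow> nat \<Rightarrow> (nat \<times> real) option" where
  "walk v n \<equiv> jumps E U v s\<^sub>0 n"

abbreviation at_time :: "nat \<Rightarrow> real \<Rightarrow> nat \<Rightarrow> bool" where
  "at_time v \<equiv> Theta_at E U v s\<^sub>0"

lemma walk_time_ge: "walk v n = Some (x, r) \<Longrightarrow> s\<^sub>0 \<le> r"
proof (induction n arbitrary: x r)
  case (Suc n)
  then obtain y r' where y: "walk v n = Some (y, r')" "next_jump E U (y, r') = Some (x, r)"
    by (auto simp: bind_eq_Some_conv)
  have "s\<^sub>0 \<le> r'" by (rule Suc.IH[OF y(1)])
  then show ?case using next_jumpE[OF _ y(2)] s0_nonneg by force
qed simp

lemma walk_Suc: "walk v n = Some (x, r) \<Longrightarrow> walk v (Suc n) = next_jump E U (x, r)"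
  by simp

lemma walk_time_nonneg: "walk v n = Some (x, r) \<Longrightarrow> 0 \<le> r"
  using walk_time_ge s0_nonneg by fastforce

lemma walk_earlier:
  "walk v m = Some (y, r') \<Longrightarrow> n \<le> m \<Longrightarrow> \<exists>x r. walk v n = Some (x, r) \<and> r \<le> r'"
proof (induction m arbitrary: y r')
  case (Suc m)
  show ?case
  proof (cases "n = Suc m")
    case True
    then show ?thesis using Suc.prems by (intro exI[of _ y] exI[of _ r']) simp
  next
    case False
    obtain z q where z: "walk v m = Some (z, q)" "next_jump E U (z, q) = Some (y, r')"
      using Suc.prems by (auto simp: bind_eq_Some_conv)
    have "q < r'" using next_jumpE[OF walk_time_nonneg[OF z(1)] z(2)] by blast
    moreover obtain x r where "walk v n = Some (x, r)" "r \<le> q"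
      using Suc.IH[OF z(1)] False Suc.prems(2) by auto
    ultimately show ?thesis by (intro exI[of _ x] exI[of _ r]) simp
  qed
qed simp

text \<open>Jump times increase, so the jump that witnesses \<open>Theta_at\<close> is the last one
  by time \<open>t\<close>.\<close>

lemma at_timeE:
  assumes "at_time v t x"
  obtains n r where "walk v n = Some (x, r)" "r \<le> t"
    "\<And>m y r'. walk v m = Some (y, r') \<Longrightarrow> r' \<le> t \<Longrightarrow> m \<le> n"
    "\<And>y r'. next_jump E U (x, r) = Some (y, r') \<Longrightarrow> t < r'"
proof -
  obtain n r where n: "walk v n = Some (x, r)" "r \<le> t"
    "\<And>y r'. walk v (Suc n) = Some (y, r') \<Longrightarrow> t < r'"
    using assms unfolding Theta_at_def by blast
  have "m \<le> n" if m: "walk v m = Some (y, r')" "r' \<le> t" for m y r'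
  proof (rule ccontr)
    assume "\<not> m \<le> n"
    then obtain z q where "walk v (Suc n) = Some (z, q)" "q \<le> r'"
      using walk_earlier[OF m(1), of "Suc n"] by auto
    then show False using n(3) m(2) by force
  qed
  moreover have "t < r'" if "next_jump E U (x, r) = Some (y, r')" for y r'
    using n(3) walk_Suc[OF n(1)] that by simp
  ultimately show thesis using that n(1,2) by blast
qed

lemma at_timeI:
  assumes "walk v n = Some (x, r)" "r \<le> t" "\<And>y r'. next_jump E U (x, r) = Some (y, r') \<Longrightarrow> t < r'"
  shows "at_time v t x"
  unfolding Theta_at_def using assms walk_Suc[OF assms(1)]
  by (intro exI[of _ n] exI[of _ r]) simp

lemma at_time_unique:
  assumes "at_time v t x" "at_time v t y"
  shows "x = y"
proof -
  obtain n r where n: "walk v n = Some (x, r)" "r \<le> t"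
    "\<And>m y r'. walk v m = Some (y, r') \<Longrightarrow> r' \<le> t \<Longrightarrow> m \<le> n"
    using at_timeE[OF assms(1)] by metis
  obtain m r' where m: "walk v m = Some (y, r')" "r' \<le> t"
    "\<And>n y r'. walk v n = Some (y, r') \<Longrightarrow> r' \<le> t \<Longrightarrow> n \<le> m"
    using at_timeE[OF assms(2)] by metis
  have "n = m" using n(3)[OF m(1,2)] m(3)[OF n(1,2)] by simp
  then show ?thesis using n(1) m(1) by simp
qed

lemma at_time_start: "at_time v s\<^sub>0 v"
proof (rule at_timeI[of _ 0])
  fix y r' assume "next_jump E U (v, s\<^sub>0) = Some (y, r')"
  then show "s\<^sub>0 < r'" by (rule next_jumpE[OF s0_nonneg])
qed auto

lemma at_time_stay:
  assumes "at_time v s a" "s \<le> s'" "\<And>u \<tau>. (a, u) \<in> E \<Longrightarrow> \<tau> \<in> U (a, u) \<Longrightarrow> s < \<tau> \<Longrightarrow> s' < \<tau>"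
  shows "at_time v s' a"
proof -
  obtain n r where n: "walk v n = Some (a, r)" "r \<le> s"
    "\<And>y r'. next_jump E U (a, r) = Some (y, r') \<Longrightarrow> s < r'"
    using at_timeE[OF assms(1)] by metis
  show ?thesis
  proof (rule at_timeI[OF n(1)])
    fix y r' assume j: "next_jump E U (a, r) = Some (y, r')"
    show "s' < r'"
      by (rule next_jumpE[OF walk_time_nonneg[OF n(1)] j]) (use assms(3) n(3)[OF j] in blast)
  qed (use n(2) assms(2) in simp)
qed

text \<open>The walk may have reached \<open>a\<close> at some \<open>r\<close> before
  \<open>s\<close>. It is still there at \<open>s\<close>, so no clock at \<open>a\<close> rings
  between \<open>r\<close> and \<open>s\<close>, and \<open>\<tau>\<close> is the first ring after
  \<open>r\<close> as well.\<close>

lemma at_time_jump: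
  assumes "at_time v s a" "(a, u) \<in> E" "\<tau> \<in> U (a, u)" "s < \<tau>"
    and first: "\<And>u' \<tau>'. (a, u') \<in> E \<Longrightarrow> \<tau>' \<in> U (a, u') \<Longrightarrow> s < \<tau>' \<Longrightarrow> \<tau> \<le> \<tau>'"
  shows "at_time v \<tau> u"
proof -
  obtain n r where n: "walk v n = Some (a, r)" "r \<le> s"
    "\<And>y r'. next_jump E U (a, r) = Some (y, r') \<Longrightarrow> s < r'"
    using at_timeE[OF assms(1)] by metis
  have r: "0 \<le> r" by (rule walk_time_nonneg[OF n(1)])
  have "\<tau> \<in> rings a r" using assms n(2) by (auto simp: rings_def)
  then have "next_jump E U (a, r) \<noteq> None"
    by (auto simp: next_jump_def rings_def[symmetric] Let_def)
  then obtain y r' where j: "next_jump E U (a, r) = Some (y, r')" by auto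
  have min: "\<tau> \<le> t" if "t \<in> rings a r" for t
    by (rule next_jumpE[OF r j]) (use first n(3)[OF j] that in fastforce)
  have "walk v (Suc n) = Some (u, \<tau>)"
    unfolding walk_Suc[OF n(1)] using assms n(2) min by (intro next_jump_eq r) auto
  then show ?thesis
  proof (rule at_timeI)
    fix z q assume k: "next_jump E U (u, \<tau>) = Some (z, q)"
    have "0 \<le> \<tau>" using r n(2) assms(4) by simp
    from next_jumpE[OF this k] show "\<tau> < q" by blast
  qed simp
qed

section \<open>Agreement of the discrete pair with two walks for short steps\<close>

definition visited :: "nat \<Rightarrow> real \<Rightarrow> nat set" where
  "visited v T = {a. \<exists>n r. walk v n = Some (a, r) \<and> r \<le> T}"

text \<open>\<open>Theta_at\<close> names a last jump by time \<open>T\<close>, so a walk that has a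
  position at \<open>T\<close> has met only finitely many clocks.\<close>

lemma finite_visited:
  assumes "at_time v T z"
  shows "finite (visited v T)"
proof -
  obtain n where n: "\<And>m y r'. walk v m = Some (y, r') \<Longrightarrow> r' \<le> T \<Longrightarrow> m \<le> n"
    using at_timeE[OF assms] by metis
  have "visited v T \<subseteq> (\<lambda>m. fst (the (walk v m))) ` {..n}"
  proof
    fix a assume "a \<in> visited v T"
    then obtain m r where m: "walk v m = Some (a, r)" "r \<le> T" by (auto simp: visited_def)
    then show "a \<in> (\<lambda>m. fst (the (walk v m))) ` {..n}"
      using n[OF m] by (intro image_eqI[of _ _ m]) auto
  qed
  then show ?thesis by (rule finite_subset) simp
qed

lemma at_time_visited: "at_time v s a \<Longrightarrow> s \<le> T \<Longrightarrow> a \<in> visited v T"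
  unfolding Theta_at_def visited_def by force

definition step_count :: "real \<Rightarrow> (nat \<times> nat) \<times> nat \<Rightarrow> nat" where
  "step_count h p = card (U (fst p) \<inter> step_interval s\<^sub>0 h (snd p))"

lemma only_rings_step_count:
  assumes "\<And>e \<tau>. e \<in> out_edges E W \<Longrightarrow> \<tau> \<in> U e \<inter> step_interval s\<^sub>0 h i \<Longrightarrow> e = e\<^sub>0 \<and> \<tau> = \<tau>\<^sub>0"
    and "\<tau>\<^sub>0 \<in> U e\<^sub>0 \<inter> step_interval s\<^sub>0 h i"
  shows "only_rings E (step_count h) i W {e\<^sub>0}"
  unfolding only_rings_def
proof
  fix e assume e: "e \<in> out_edges E W"
  have "U e \<inter> step_interval s\<^sub>0 h i = (if e = e\<^sub>0 then {\<tau>\<^sub>0} else {})"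
  proof (cases "e = e\<^sub>0")
    case True
    have "U e \<inter> step_interval s\<^sub>0 h i \<subseteq> {\<tau>\<^sub>0}" using assms(1)[OF e] by blast
    moreover have "\<tau>\<^sub>0 \<in> U e \<inter> step_interval s\<^sub>0 h i" unfolding True by (rule assms(2))
    ultimately have "U e \<inter> step_interval s\<^sub>0 h i = {\<tau>\<^sub>0}" by blast
    then show ?thesis unfolding if_P[OF True] .
  next
    case False
    then have "U e \<inter> step_interval s\<^sub>0 h i = {}" using assms(1)[OF e] by blast
    then show ?thesis unfolding if_not_P[OF False] .
  qed
  then show "step_count h (e, i) = of_bool (e \<in> {e\<^sub>0})" by (simp add: step_count_def)
qed

text \<open>If each step contains at most one ring of the clocks at visited vertices, the pair is
  never killed and follows the two walks, by induction on the number of remaining steps.\<close>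

lemma pair_run_ge_1:
  assumes h: "0 \<le> h"
    and fin: "at_time x T z" "at_time y T z"
    and single: "\<And>e e' \<tau> \<tau>' i. e \<in> out_edges E (visited x T \<union> visited y T) \<Longrightarrow>
      e' \<in> out_edges E (visited x T \<union> visited y T) \<Longrightarrow>
      \<tau> \<in> U e \<inter> step_interval s\<^sub>0 h i \<Longrightarrow> \<tau>' \<in> U e' \<inter> step_interval s\<^sub>0 h i \<Longrightarrow> \<tau> \<le> T \<Longrightarrow> \<tau>' \<le> T \<Longrightarrow>
      e = e' \<and> \<tau> = \<tau>'"
  shows "s\<^sub>0 + real (i + n) * h = T \<Longrightarrow> at_time x (s\<^sub>0 + real i * h) a \<Longrightarrow> at_time y (s\<^sub>0 + real i * h) b \<Longrightarrow>
    1 \<le> pair_run E (step_count h) z n i a b"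
proof (induction n arbitrary: i a b)
  case 0
  then have "a = z" "b = z" using at_time_unique fin by auto
  then show ?case by simp
next
  case (Suc n)
  let ?W = "visited x T \<union> visited y T" and ?J = "step_interval s\<^sub>0 h i"
  let ?s = "s\<^sub>0 + real i * h" and ?s' = "s\<^sub>0 + real (Suc i) * h"
  let ?c = "step_count h"
  have "real i * h \<le> real (Suc i) * h" using h by (intro mult_right_mono) auto
  then have ss': "?s \<le> ?s'" by simp
  have "real (Suc i) * h \<le> real (i + Suc n) * h" using h by (intro mult_right_mono) auto
  then have s'T: "?s' \<le> T" using Suc.prems(1) by simp
  have J: "\<tau> \<in> ?J \<longleftrightarrow> ?s < \<tau> \<and> \<tau> \<le> ?s'" for \<tau> by (auto simp: step_interval_def)
  have IH: "1 \<le> pair_run E ?c z n (Suc i) a' b'" if "at_time x ?s' a'" "at_time y ?s' b'" for a' b'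
    using Suc.prems(1) that by (intro Suc.IH) auto
  have aW: "a \<in> ?W" and bW: "b \<in> ?W"
    using at_time_visited Suc.prems(2,3) ss' s'T by fastforce+
  \<comment> \<open>The target \<open>u\<close> is itself visited by time \<open>T\<close>, so its
    clocks are among those that share the single ring \<open>\<tau>\<close>. They are silent in this
    step, and the walk is still at \<open>u\<close> when the step ends.\<close>
  have move: "at_time v ?s' u \<and> u \<in> visited v T \<and> (a' \<in> ?W \<longrightarrow> v \<in> {x, y} \<longrightarrow> (\<forall>W \<subseteq> ?W. only_rings E ?c i (insert u W) {(a', u)}))"
    if v: "at_time v ?s a'" "v \<in> {x, y}" and u: "(a', u) \<in> E" "\<tau> \<in> U (a', u)" "\<tau> \<in> ?J" for v a' u \<tau>
  proof -
    have a'W: "a' \<in> ?W" using at_time_visited[OF v(1)] v(2) ss' s'T by auto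
    have e: "(a', u) \<in> out_edges E ?W" using a'W u by (auto simp: out_edges_def)
    have \<tau>T: "\<tau> \<le> T" using u(3) s'T J by simp
    have only: "e' = (a', u) \<and> \<tau>' = \<tau>" if "e' \<in> out_edges E ?W" "\<tau>' \<in> U e'" "\<tau>' \<in> ?J" for e' \<tau>'
      using single[OF that(1) e, of \<tau>' i \<tau>] that u \<tau>T J s'T by auto
    have v\<tau>: "at_time v \<tau> u"
    proof (rule at_time_jump[OF v(1) u(1,2)])
      show "?s < \<tau>" using u(3) J by simp
      fix u' \<tau>' assume \<tau>': "(a', u') \<in> E" "\<tau>' \<in> U (a', u')" "?s < \<tau>'"
      show "\<tau> \<le> \<tau>'"
      proof (cases "\<tau>' \<le> ?s'")
        case True
        then have "\<tau>' = \<tau>" using only[of "(a', u')" \<tau>'] \<tau>' a'W J by (auto simp: out_edges_def)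
        then show ?thesis by simp
      next
        case False
        then show ?thesis using u(3) J by simp
      qed
    qed
    have uv: "u \<in> visited v T" by (rule at_time_visited[OF v\<tau> \<tau>T])
    then have uW: "u \<in> ?W" using v(2) by auto
    have "at_time v ?s' u"
    proof (rule at_time_stay[OF v\<tau>])
      show "\<tau> \<le> ?s'" using u(3) J by simp
      fix w \<tau>' assume \<tau>': "(u, w) \<in> E" "\<tau>' \<in> U (u, w)" "\<tau> < \<tau>'"
      show "?s' < \<tau>'"
      proof (rule ccontr)
        assume "\<not> ?s' < \<tau>'"
        then have "\<tau>' = \<tau>"
          using only[of "(u, w)" \<tau>'] \<tau>' uW J u(3) by (auto simp: out_edges_def)
        then show False using \<tau>'(3) by simp
      qed
    qed
    moreover have "only_rings E ?c i (insert u W) {(a', u)}" if "W \<subseteq> ?W" for W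
    proof (rule only_rings_step_count)
      fix e' \<tau>' assume "e' \<in> out_edges E (insert u W)" "\<tau>' \<in> U e' \<inter> ?J"
      then show "e' = (a', u) \<and> \<tau>' = \<tau>" using only[of e' \<tau>'] that uW by (auto simp: out_edges_def)
    qed (use u in simp)
    ultimately show ?thesis using uv by simp
  qed
  have stay: "at_time v ?s' a'"
    if "at_time v ?s a'" "\<And>u \<tau>. (a', u) \<in> E \<Longrightarrow> \<tau> \<in> U (a', u) \<Longrightarrow> \<tau> \<notin> ?J" for v a'
    using that ss' J by (intro at_time_stay[OF that(1) ss']) force
  have unique: "e = e'" if "e \<in> out_edges E ?W" "e' \<in> out_edges E ?W" "\<tau> \<in> U e \<inter> ?J" "\<tau>' \<in> U e' \<inter> ?J" for e e' \<tau> \<tau>'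
    using single[OF that] that(3,4) J s'T by auto
  \<comment> \<open>For \<open>a = b\<close> a ring moves both walks; it falls under the second
    case, and the third is reserved for separate walks.\<close>
  consider (none) "\<And>u \<tau>. (a, u) \<in> E \<Longrightarrow> \<tau> \<in> U (a, u) \<Longrightarrow> \<tau> \<notin> ?J" "\<And>u \<tau>. (b, u) \<in> E \<Longrightarrow> \<tau> \<in> U (b, u) \<Longrightarrow> \<tau> \<notin> ?J"
    | (a) u \<tau> where "(a, u) \<in> E" "\<tau> \<in> U (a, u)" "\<tau> \<in> ?J"
    | (b) u \<tau> where "a \<noteq> b" "(b, u) \<in> E" "\<tau> \<in> U (b, u)" "\<tau> \<in> ?J"
    by (cases "a = b") auto
  then show ?case
  proof cases
    case none
    have "only_rings E ?c i {a, b} {}"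
      unfolding only_rings_def step_count_def using none
      by (auto simp: out_edges_def card_eq_0_iff)
    moreover have "1 \<le> pair_run E ?c z n (Suc i) a b"
      using none by (intro IH stay[OF Suc.prems(2)] stay[OF Suc.prems(3)])
    ultimately show ?thesis by (simp add: add_increasing2)
  next
    case a
    have X: "at_time x ?s' u" "\<And>W. W \<subseteq> ?W \<Longrightarrow> only_rings E ?c i (insert u W) {(a, u)}"
      using move[OF Suc.prems(2) _ a] aW by auto
    have R: "only_rings E ?c i {a, b, u} {(a, u)}"
      using X(2)[of "{a, b}"] aW bW by (simp add: insert_commute)
    have "at_time y ?s' (if a = b then u else b)"
    proof (cases "a = b")
      case True
      then show ?thesis using move[of y a u \<tau>] Suc.prems(3) a by simp
    next
      case False
      have "at_time y ?s' b"
      proof (rule stay[OF Suc.prems(3)])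
        fix w \<tau>' assume "(b, w) \<in> E" "\<tau>' \<in> U (b, w)"
        then show "\<tau>' \<notin> ?J"
          using unique[of "(a, u)" "(b, w)" \<tau> \<tau>'] a aW bW False by (auto simp: out_edges_def)
      qed
      then show ?thesis using False by simp
    qed
    from IH[OF X(1) this] R
    have "1 \<le> of_bool (only_rings E ?c i {a, b, u} {(a, u)}) *
        pair_run E ?c z n (Suc i) u (if a = b then u else b)" by simp
    also have "\<dots> \<le> (\<Sum>u\<in>E `` {a}. of_bool (only_rings E ?c i {a, b, u} {(a, u)}) *
        pair_run E ?c z n (Suc i) u (if a = b then u else b))"
      by (rule member_le_sum) (use a finite_nbrs in auto)
    also have "\<dots> \<le> pair_run E ?c z (Suc n) i a b"
      unfolding pair_run.simps by (intro add_increasing2 add_increasing) auto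
    finally show ?thesis .
  next
    case b
    have Y: "at_time y ?s' u" "\<And>W. W \<subseteq> ?W \<Longrightarrow> only_rings E ?c i (insert u W) {(b, u)}"
      using move[OF Suc.prems(3) _ b(2-)] bW by auto
    have R: "only_rings E ?c i {a, b, u} {(b, u)}"
      using Y(2)[of "{a, b}"] aW bW by (simp add: insert_commute)
    have "at_time x ?s' a"
    proof (rule stay[OF Suc.prems(2)])
      fix w \<tau>' assume "(a, w) \<in> E" "\<tau>' \<in> U (a, w)"
      then show "\<tau>' \<notin> ?J"
        using unique[of "(b, u)" "(a, w)" \<tau> \<tau>'] b aW bW by (auto simp: out_edges_def)
    qed
    from IH[OF this Y(1)] R
    have "1 \<le> of_bool (only_rings E ?c i {a, b, u} {(b, u)}) * pair_run E ?c z n (Suc i) a u" by simp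
    also have "\<dots> \<le> (\<Sum>v\<in>E `` {b}. of_bool (only_rings E ?c i {a, b, v} {(b, v)}) * pair_run E ?c z n (Suc i) a v)"
      by (rule member_le_sum) (use b finite_nbrs in auto)
    also have "\<dots> \<le> pair_run E ?c z (Suc n) i a b"
      unfolding pair_run.simps using b(1) by (simp add: add_increasing)
    finally show ?thesis .
  qed
qed

lemma finite_set_gap:
  assumes "finite (S :: real set)"
  shows "\<exists>\<delta>>0. \<forall>x\<in>S. \<forall>y\<in>S. x < y \<longrightarrow> \<delta> \<le> y - x"
proof -
  \<comment> \<open>The element 1 keeps the set nonempty, so that its minimum exists.\<close>
  define D where "D = insert 1 {d. 0 < d \<and> (\<exists>x\<in>S. \<exists>y\<in>S. d = y - x)}"
  have "D \<subseteq> insert 1 (\<Union>x\<in>S. (\<lambda>y. y - x) ` S)" unfolding D_def by blast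
  then have fin: "finite D" by (rule finite_subset) (use assms in simp)
  have "Min D \<in> D" by (rule Min_in[OF fin]) (simp add: D_def)
  then have "0 < Min D" unfolding D_def by auto
  moreover have "Min D \<le> y - x" if "x \<in> S" "y \<in> S" "x < y" for x y
  proof (rule Min_le[OF fin])
    have "0 < y - x" using that(3) by simp
    then show "y - x \<in> D" unfolding D_def using that(1,2) by blast
  qed
  ultimately show ?thesis by (intro exI[of _ "Min D"]) simp
qed

text \<open>The clocks at visited vertices ring at finitely many times up to \<open>T\<close>. Once
  the step length is below the smallest gap, a step holds at most one of these times, and no two
  clocks share it.\<close>

lemma eventually_pair_run_ge_1:
  assumes "s\<^sub>0 \<le> T" "at_time x T z" "at_time y T z"
  shows "\<forall>\<^sub>F n in sequentially.
    1 \<le> pair_run E (step_count ((T - s\<^sub>0) / real (Suc n))) z (Suc n) 0 x y"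
proof -
  let ?D = "out_edges E (visited x T \<union> visited y T)"
  have D: "finite ?D" using finite_visited assms(2,3) by (intro finite_out_edges finite_nbrs) simp
  have "finite (\<Union>e\<in>?D. U e \<inter> {0..T})"
    by (intro finite_UN_I D finite_rings) (simp add: out_edges_def)
  from finite_set_gap[OF this] obtain \<delta> where \<delta>: "0 < \<delta>"
    "\<And>\<tau> \<tau>' e e'. e \<in> ?D \<Longrightarrow> e' \<in> ?D \<Longrightarrow> \<tau> \<in> U e \<inter> {0..T} \<Longrightarrow> \<tau>' \<in> U e' \<inter> {0..T} \<Longrightarrow> \<tau> < \<tau>' \<Longrightarrow> \<delta> \<le> \<tau>' - \<tau>"
    by blast
  have "(\<lambda>n. (T - s\<^sub>0) / real (Suc n)) \<longlonglongrightarrow> 0"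
    using tendsto_mult_left[OF LIMSEQ_inverse_real_of_nat, of "T - s\<^sub>0"]
    by (simp add: divide_inverse del: of_nat_Suc)
  then have "\<forall>\<^sub>F n in sequentially. (T - s\<^sub>0) / real (Suc n) < \<delta>"
    using \<delta>(1) by (rule order_tendstoD)
  then show ?thesis
  proof eventually_elim
    fix n assume n: "(T - s\<^sub>0) / real (Suc n) < \<delta>"
    define h where "h = (T - s\<^sub>0) / real (Suc n)"
    have h: "0 \<le> h" "h < \<delta>" "s\<^sub>0 + real (0 + Suc n) * h = T"
      using assms(1) n by (simp_all add: h_def del: of_nat_Suc)
    have "1 \<le> pair_run E (step_count h) z (Suc n) 0 x y"
    proof (rule pair_run_ge_1[OF h(1) assms(2,3) _ h(3)])
      fix e e' \<tau> \<tau>' i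
      assume *: "e \<in> ?D" "e' \<in> ?D" "\<tau> \<in> U e \<inter> step_interval s\<^sub>0 h i" "\<tau>' \<in> U e' \<inter> step_interval s\<^sub>0 h i"
        "\<tau> \<le> T" "\<tau>' \<le> T"
      have pos: "0 < \<tau>" "0 < \<tau>'" using * step_interval_subset[OF h(1), of s\<^sub>0 i] s0_nonneg by auto
      have "\<bar>\<tau> - \<tau>'\<bar> < \<delta>" using *(3,4) h(2) by (simp add: step_interval_def distrib_right abs_less_iff)
      moreover have "\<delta> \<le> \<tau>' - \<tau>" if "\<tau> < \<tau>'"
        by (rule \<delta>(2)[OF *(1,2) _ _ that]) (use * pos in simp_all)
      moreover have "\<delta> \<le> \<tau> - \<tau>'" if "\<tau>' < \<tau>"
        by (rule \<delta>(2)[OF *(2,1) _ _ that]) (use * pos in simp_all)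
      ultimately have eq: "\<tau> = \<tau>'" by linarith
      have "e = e'"
        by (rule no_common_ring[OF _ _ pos(1)]) (use * eq in \<open>simp_all add: out_edges_def\<close>)
      with eq show "e = e' \<and> \<tau> = \<tau>'" by simp
    qed (use at_time_start in simp_all)
    then show "1 \<le> pair_run E (step_count ((T - s\<^sub>0) / real (Suc n))) z (Suc n) 0 x y"
      by (simp only: h_def)
  qed
qed

end

section \<open>The second moment\<close>

text \<open>Each step crosses at most one edge, and symmetry lets distances be measured from
  \<open>z\<close>. The infinite sums over starting points thus become sums over balls, which are
  local.\<close>

lemma pair_prob_support:
  assumes "sym E"
  shows "pair_prob h E n z a b \<noteq> 0 \<Longrightarrow> a \<in> nball E n {z} \<and> b \<in> nball E n {z}"
proof (induction n arbitrary: a b)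
  case 0
  then show ?case by (auto split: if_splits)
next
  case (Suc n)
  have step: "v \<in> nball E (Suc n) {z}" if vu: "(v, u) \<in> E" and u: "u \<in> nball E n {z}" for u v
  proof -
    obtain i where i: "i \<le> n" "(z, u) \<in> E ^^ i" using u by (auto simp: nball_def)
    moreover have "(u, v) \<in> E" using assms vu by (auto dest: symD)
    ultimately have "(z, v) \<in> E ^^ Suc i" by auto
    then show ?thesis using i(1) by (intro nballI[of z _ "Suc i"]) simp_all
  qed
  have mono: "u \<in> nball E (Suc n) {z}" if "u \<in> nball E n {z}" for u
    using nball_mono[of n "Suc n" "{z}" "{z}" E] that by auto
  have "pair_prob h E n z a b \<noteq> 0 \<or>
      (\<exists>u\<in>E `` {a}. pair_prob h E n z u (if a = b then u else b) \<noteq> 0) \<or>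
      (\<exists>v\<in>E `` {b}. pair_prob h E n z a v \<noteq> 0)"
  proof (rule ccontr)
    assume "\<not> ?thesis"
    then have 0: "pair_prob h E n z a b = 0"
      "\<And>u. u \<in> E `` {a} \<Longrightarrow> pair_prob h E n z u (if a = b then u else b) = 0"
      "\<And>v. v \<in> E `` {b} \<Longrightarrow> pair_prob h E n z a v = 0" by blast+
    have "(\<Sum>u\<in>E `` {a}. ennreal h * quiet_weight h E {a, b, u} *
          pair_prob h E n z u (if a = b then u else b)) = 0"
      by (intro sum.neutral ballI) (simp only: 0(2) mult_zero_right)
    moreover have "(\<Sum>v\<in>E `` {b}. ennreal h * quiet_weight h E {a, b, v} * pair_prob h E n z a v) = 0"
      by (intro sum.neutral ballI) (simp only: 0(3) mult_zero_right)
    ultimately have "pair_prob h E (Suc n) z a b = 0"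
      unfolding pair_prob.simps 0(1) by (simp only: mult_zero_right add_0_right if_cancel)
    then show False using Suc.prems by simp
  qed
  then consider "pair_prob h E n z a b \<noteq> 0"
    | u where "u \<in> E `` {a}" "pair_prob h E n z u (if a = b then u else b) \<noteq> 0"
    | v where "v \<in> E `` {b}" "pair_prob h E n z a v \<noteq> 0"
    by blast
  then show ?case
  proof cases
    case 1
    then show ?thesis using Suc.IH mono by blast
  next
    case 2
    have u: "u \<in> nball E n {z}" and b: "(if a = b then u else b) \<in> nball E n {z}"
      using Suc.IH[OF 2(2)] by auto
    have "a \<in> nball E (Suc n) {z}" using step[of a u] 2(1) u by simp
    then show ?thesis using mono[OF b] by (cases "a = b") auto
  next
    case 3
    then show ?thesis using Suc.IH[OF 3(2)] step[of b v] mono by auto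
  qed
qed

lemma pair_prob_eq_0:
  assumes "sym E" "a \<notin> nball E n {z} \<or> b \<notin> nball E n {z}"
  shows "pair_prob h E n z a b = 0"
  using pair_prob_support[OF assms(1), of h n z a b] assms(2) by argo

lemma nn_integral_finite_support:
  assumes "finite A" "\<And>x. x \<notin> A \<Longrightarrow> f x = 0"
  shows "(\<integral>\<^sup>+x. f x \<partial>count_space UNIV) = (\<Sum>x\<in>A. f x)"
  using assms by (intro nn_integral_count_space') auto

text \<open>The mass sent from \<open>x\<close> to \<open>z\<close> for \<open>rs = [x, z]\<close>:
  the expected number of walks that the surviving pair chain brings to \<open>z\<close> together
  with the walk from \<open>x\<close>.\<close>

definition pair_sum :: "real \<Rightarrow> nat \<Rightarrow> (nat \<times> nat) set \<Rightarrow> nat list \<Rightarrow> ennreal" where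
  "pair_sum h n E rs = (\<Sum>y\<in>nball E n {rs ! 1}. pair_prob h E n (rs ! 1) (rs ! 0) y)"

lemma local_fun_pair_sum: "local_fun 2 (pair_sum h n)"
proof -
  have "local_fun 3 (\<lambda>E rs. pair_prob h E n (rs ! 1) (rs ! 0) (rs ! 2))"
    using local_fun_reindex[of "[1, 0, 2]" "\<lambda>E rs. pair_prob h E n (rs ! 0) (rs ! 1) (rs ! 2)" 3]
      local_fun_pair_prob[of h n] by (simp add: numeral_3_eq_3 numeral_2_eq_2)
  then have "local_fun (Suc 2) (\<lambda>E rs. pair_prob h E n (rs ! 1) (rs ! 0) (rs ! 2))"
    by (simp add: numeral_3_eq_3 numeral_2_eq_2)
  then have "local_fun 2 (\<lambda>E rs. \<Sum>u\<in>nball E n {rs ! 1}.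
      pair_prob h E n ((rs @ [u]) ! 1) ((rs @ [u]) ! 0) ((rs @ [u]) ! 2))"
    by (rule local_fun_sum_nball) simp
  moreover have "local_fun 2 (\<lambda>E rs. \<Sum>u\<in>nball E n {rs ! 1}.
      pair_prob h E n ((rs @ [u]) ! 1) ((rs @ [u]) ! 0) ((rs @ [u]) ! 2)) \<longleftrightarrow> local_fun 2 (pair_sum h n)"
    by (rule local_fun_cong) (simp add: nth_append pair_sum_def)
  ultimately show ?thesis by simp
qed

lemma local_fun_merge_rate: "local_fun 1 (\<lambda>E rs. merge_rate h E (rs ! 0))"
proof -
  have "local_fun 1 (\<lambda>E rs. 2 * ennreal h * of_nat (card (out_edges E (set rs))))"
    by (rule local_fun_comp[where F = "\<lambda>n. 2 * ennreal h * of_nat n", OF local_fun_card_out_edges])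
  moreover have "local_fun 1 (\<lambda>E rs. 2 * ennreal h * of_nat (card (out_edges E (set rs)))) \<longleftrightarrow>
      local_fun 1 (\<lambda>E rs. merge_rate h E (rs ! 0))"
    by (rule local_fun_cong) (auto simp: merge_rate_def length_Suc_conv card_out_edges_singleton)
  ultimately show ?thesis by simp
qed

text \<open>The discrete counterpart of the second moment of \<open>voter\<close> at
  \<open>r\<close> on a fixed graph.\<close>

definition total_prob :: "real \<Rightarrow> nat \<Rightarrow> (nat \<times> nat) set \<Rightarrow> nat \<Rightarrow> ennreal" where
  "total_prob h n E r =
     (\<integral>\<^sup>+x. \<integral>\<^sup>+y. pair_prob h E n r x y \<partial>count_space UNIV \<partial>count_space UNIV)"

lemma (in step_graph) nn_integral_pair_prob_eq_pair_sum:
  "(\<integral>\<^sup>+y. pair_prob h E n b a y \<partial>count_space UNIV) = pair_sum h n E [a, b]"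
  unfolding pair_sum_def
  by (subst nn_integral_finite_support[where A = "nball E n {b}"])
    (simp_all add: finite_nball finite_nbrs pair_prob_eq_0[OF sym])

lemma (in step_graph) pair_sum_support:
  assumes "a \<notin> nball E n {b}"
  shows "pair_sum h n E [a, b] = 0"
  unfolding pair_sum_def using assms by (simp add: pair_prob_eq_0[OF sym])

lemma (in step_graph) total_prob_eq:
  "total_prob h n E r = (\<Sum>x\<in>nball E n {r}. pair_sum h n E [x, r])"
  unfolding total_prob_def nn_integral_pair_prob_eq_pair_sum
  by (rule nn_integral_finite_support) (simp_all add: finite_nball finite_nbrs pair_sum_support)

lemma total_prob_measurable:
  assumes M: "random_rooted_graph M V E \<rho>" and h: "0 \<le> h"
  shows "(\<lambda>\<omega>. total_prob h n (E \<omega>) (\<rho> \<omega>)) \<in> borel_measurable M"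
proof -
  let ?f = "\<lambda>E rs. \<Sum>x\<in>nball E n {rs ! 0}. pair_sum h n E [x, rs ! 0]"
  have "local_fun (Suc 1) (\<lambda>E rs. pair_sum h n E [rs ! 1, rs ! 0])"
    using local_fun_reindex[of "[1, 0]" "pair_sum h n" "Suc 1"] local_fun_pair_sum[of h n]
    by (simp add: numeral_2_eq_2)
  then have "local_fun 1 (\<lambda>E rs. \<Sum>x\<in>nball E n {rs ! 0}. pair_sum h n E [(rs @ [x]) ! 1, (rs @ [x]) ! 0])"
    by (rule local_fun_sum_nball) simp
  moreover have "local_fun 1 (\<lambda>E rs. \<Sum>x\<in>nball E n {rs ! 0}. pair_sum h n E [(rs @ [x]) ! 1, (rs @ [x]) ! 0])
      \<longleftrightarrow> local_fun 1 ?f"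
    by (rule local_fun_cong) (simp add: nth_append)
  ultimately have "local_fun 1 ?f" by simp
  then have meas: "(\<lambda>\<omega>. ?f (E \<omega>) [\<rho> \<omega>]) \<in> borel_measurable M" by (rule random_rooted_graph_measurable[OF M])
  have "total_prob h n (E \<omega>) (\<rho> \<omega>) = ?f (E \<omega>) [\<rho> \<omega>]" if "\<omega> \<in> space M" for \<omega>
  proof -
    interpret step_graph h "E \<omega>" by (rule rooted_graph_step_graph[OF random_rooted_graphD(1)[OF M that] h])
    show ?thesis by (simp add: total_prob_eq)
  qed
  then show ?thesis using meas by (simp cong: measurable_cong)
qed

text \<open>Mass transport with \<open>pair_sum\<close> moves the root from the common end point to
  the start of the first walk, where the bound for a fixed graph applies.\<close>

lemma nn_integral_total_prob_le:
  assumes M: "random_rooted_graph M V E \<rho>" "unimodular M V E \<rho>" and h: "0 \<le> h"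
  shows "(\<integral>\<^sup>+\<omega>. total_prob h n (E \<omega>) (\<rho> \<omega>) \<partial>M)
    \<le> 1 + of_nat n * (\<integral>\<^sup>+\<omega>. merge_rate h (E \<omega>) (\<rho> \<omega>) \<partial>M)"
proof -
  interpret prob_space M using M(1) by (simp add: random_rooted_graph_def)
  note graph = rooted_graph_step_graph[OF random_rooted_graphD(1)[OF M(1)] h]
  have supp: "pair_sum h n (E \<omega>) [x, \<rho> \<omega>] = 0" if "\<omega> \<in> space M" "x \<notin> V \<omega>" for \<omega> x
  proof (rule step_graph.pair_sum_support[OF graph[OF that(1)]])
    show "x \<notin> nball (E \<omega>) n {\<rho> \<omega>}"
      using nball_subset[of "E \<omega>" "V \<omega>" "{\<rho> \<omega>}" n] random_rooted_graphD[OF M(1) that(1)] that(2) by auto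
  qed
  have "(\<integral>\<^sup>+\<omega>. total_prob h n (E \<omega>) (\<rho> \<omega>) \<partial>M) =
      (\<integral>\<^sup>+\<omega>. (\<integral>\<^sup>+x. pair_sum h n (E \<omega>) [x, \<rho> \<omega>] \<partial>count_space (V \<omega>)) \<partial>M)"
    by (intro nn_integral_cong)
      (simp add: total_prob_def step_graph.nn_integral_pair_prob_eq_pair_sum[OF graph] nn_integral_count_space_subset supp)
  also have "\<dots> = (\<integral>\<^sup>+\<omega>. (\<integral>\<^sup>+x. pair_sum h n (E \<omega>) [\<rho> \<omega>, x] \<partial>count_space (V \<omega>)) \<partial>M)"
    by (rule mass_transport[OF M local_fun_pair_sum, symmetric])
      (simp add: pair_sum_def sum_neq_top pair_prob_neq_top)
  also have "\<dots> \<le> (\<integral>\<^sup>+\<omega>. 1 + (\<Sum>k<n. (walk_op h (E \<omega>) ^^ k) (merge_rate h (E \<omega>)) (\<rho> \<omega>)) \<partial>M)"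
  proof (rule nn_integral_mono)
    fix \<omega> assume \<omega>: "\<omega> \<in> space M"
    interpret step_graph h "E \<omega>" by (rule graph[OF \<omega>])
    have "(\<integral>\<^sup>+x. pair_sum h n (E \<omega>) [\<rho> \<omega>, x] \<partial>count_space (V \<omega>)) =
        (\<integral>\<^sup>+x. pair_sum h n (E \<omega>) [\<rho> \<omega>, x] * indicator (V \<omega>) x \<partial>count_space UNIV)"
      by (simp add: nn_integral_restrict_space[symmetric] restrict_count_space)
    also have "\<dots> \<le> (\<integral>\<^sup>+x. pair_sum h n (E \<omega>) [\<rho> \<omega>, x] \<partial>count_space UNIV)"
      by (intro nn_integral_mono) (auto simp: indicator_def)
    also have "\<dots> = (\<integral>\<^sup>+x. \<integral>\<^sup>+y. pair_prob h (E \<omega>) n x (\<rho> \<omega>) y \<partial>count_space UNIV \<partial>count_space UNIV)"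
      by (simp only: nn_integral_pair_prob_eq_pair_sum)
    also have "\<dots> \<le> 1 + (\<Sum>k<n. (walk_op h (E \<omega>) ^^ k) (merge_rate h (E \<omega>)) (\<rho> \<omega>))"
      by (rule nn_integral_pair_prob_le)
    finally show "(\<integral>\<^sup>+x. pair_sum h n (E \<omega>) [\<rho> \<omega>, x] \<partial>count_space (V \<omega>)) \<le>
        1 + (\<Sum>k<n. (walk_op h (E \<omega>) ^^ k) (merge_rate h (E \<omega>)) (\<rho> \<omega>))" .
  qed
  also have "\<dots> = 1 + (\<Sum>k<n. \<integral>\<^sup>+\<omega>. (walk_op h (E \<omega>) ^^ k) (merge_rate h (E \<omega>)) (\<rho> \<omega>) \<partial>M)"
  proof -
    have top: "merge_rate h E x \<noteq> \<top>" for E x by (simp add: merge_rate_def ennreal_mult_eq_top_iff)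
    have "(\<lambda>\<omega>. (walk_op h (E \<omega>) ^^ k) (merge_rate h (E \<omega>)) (\<rho> \<omega>)) \<in> borel_measurable M" for k
      using random_rooted_graph_measurable[OF M(1)
          nn_integral_walk_op_iter_root_le(2)[OF M h local_fun_merge_rate top, of k]] by simp
    then show ?thesis by (simp add: nn_integral_add nn_integral_sum emeasure_space_1)
  qed
  \<comment> \<open>The walk does not increase expectations at the root, so all \<open>n\<close>
    terms have the same bound.\<close>
  also have "\<dots> \<le> 1 + (\<Sum>k<n. \<integral>\<^sup>+\<omega>. merge_rate h (E \<omega>) (\<rho> \<omega>) \<partial>M)"
    by (intro add_left_mono sum_mono nn_integral_walk_op_iter_root_le(1)[OF M h local_fun_merge_rate])
      (simp add: merge_rate_def ennreal_mult_eq_top_iff)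
  finally show ?thesis by simp
qed

section \<open>Passage from the discrete chain to the voter model\<close>

lemma nn_integral_count_space_commute:
  fixes f :: "nat \<Rightarrow> 'w \<Rightarrow> ennreal"
  assumes "\<And>x. f x \<in> borel_measurable N"
  shows "(\<lambda>w. \<integral>\<^sup>+x. f x w \<partial>count_space UNIV) \<in> borel_measurable N"
    and "(\<integral>\<^sup>+w. \<integral>\<^sup>+x. f x w \<partial>count_space UNIV \<partial>N) = (\<integral>\<^sup>+x. \<integral>\<^sup>+w. f x w \<partial>N \<partial>count_space UNIV)"
  using assms by (simp_all add: nn_integral_count_space_nat nn_integral_suminf)

text \<open>The squared cardinality is a sum over pairs \<open>x\<close>, \<open>y\<close> of
  products of indicators, also when infinite. Almost surely each product is bounded by the limit
  inferior of the discrete runs \<open>J\<close>.\<close>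

lemma voter_second_moment_le:
  assumes graph: "rooted_graph 1 (V, E, [r])" and clocks: "poisson_clocks E N U" and t: "0 \<le> t" "t \<le> T"
  shows "(\<integral>\<^sup>+w. (emeasure (count_space UNIV) (voter V E (\<lambda>e. U e w) T t r))\<^sup>2 \<partial>N)
    \<le> liminf (\<lambda>n. total_prob (t / real (Suc n)) (Suc n) E r)"
proof -
  \<comment> \<open>The walks counted by \<open>voter\<close> start at time \<open>T - t\<close>;
    the steps divide the time from there to \<open>T\<close>, and the law of their counts does not
    depend on \<open>T\<close>.\<close>
  define s where "s = T - t"
  have s: "0 \<le> s" "s \<le> T" "T - s = t" using t by (simp_all add: s_def)
  let ?h = "\<lambda>n. t / real (Suc n)"
  have h: "0 \<le> ?h n" for n using t by simp
  define X where "X n p w = card (U (fst p) w \<inter> step_interval s (?h n) (snd p))" for n p w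
  define J where "J n x y w = pair_run E (\<lambda>p. X n p w) r (Suc n) 0 x y" for n x y w
  have steps: "poisson_steps (?h n) E N (X n)" for n
    unfolding X_def by (rule poisson_clocks_steps[OF clocks rooted_graph_step_graph[OF graph h] s(1)])
  have J_meas: "J n x y \<in> borel_measurable N" for n x y
    unfolding J_def by (rule poisson_steps.measurable_pair_run_X[OF steps])
  have J_int: "(\<integral>\<^sup>+w. J n x y w \<partial>N) = pair_prob (?h n) E (Suc n) r x y" for n x y
    unfolding J_def by (rule poisson_steps.nn_integral_pair_run[OF steps])
  let ?S = "\<lambda>n w. \<integral>\<^sup>+x. \<integral>\<^sup>+y. J n x y w \<partial>count_space UNIV \<partial>count_space UNIV"
  have inner_meas: "(\<lambda>w. \<integral>\<^sup>+y. J n x y w \<partial>count_space UNIV) \<in> borel_measurable N" for n x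
    by (rule nn_integral_count_space_commute(1)[OF J_meas])
  have S_meas: "?S n \<in> borel_measurable N" for n
    by (rule nn_integral_count_space_commute(1)[OF inner_meas])
  have S_int: "(\<integral>\<^sup>+w. ?S n w \<partial>N) = total_prob (?h n) (Suc n) E r" for n
    unfolding nn_integral_count_space_commute(2)[OF inner_meas] nn_integral_count_space_commute(2)[OF J_meas]
      J_int total_prob_def ..
  have "AE w in N. e \<noteq> e' \<longrightarrow> U e w \<inter> U e' w \<inter> {0<..} = {}" if "e \<in> E" "e' \<in> E" for e e'
    using poisson_clocks_disjoint_AE[OF clocks that] by (cases "e = e'") simp_all
  then have "AE w in N. \<forall>e\<in>E. \<forall>e'\<in>E. e \<noteq> e' \<longrightarrow> U e w \<inter> U e' w \<inter> {0<..} = {}"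
    by (simp add: AE_ball_countable[OF countableI_type])
  then have "AE w in N. (emeasure (count_space UNIV) (voter V E (\<lambda>e. U e w) T t r))\<^sup>2 \<le> liminf (\<lambda>n. ?S n w)"
    using AE_space
  proof eventually_elim
    fix w assume disj: "\<forall>e\<in>E. \<forall>e'\<in>E. e \<noteq> e' \<longrightarrow> U e w \<inter> U e' w \<inter> {0<..} = {}" and w: "w \<in> space N"
    interpret clock_realization E "\<lambda>e. U e w" s
    proof
      show "finite (E `` {v})" for v
        using rooted_graph_step_graph[OF graph order_refl] by (rule step_graph.finite_nbrs)
      show "finite (U e w \<inter> {0..b})" if "e \<in> E" for e b
        by (rule poisson_clocks_locally_finite(2)[OF clocks that w])
      show "e = e'" if "e \<in> E" "e' \<in> E" "0 < \<tau>" "\<tau> \<in> U e w" "\<tau> \<in> U e' w" for e e' \<tau>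
      proof (rule ccontr)
        assume "e \<noteq> e'"
        with disj that(1,2) have "U e w \<inter> U e' w \<inter> {0<..} = {}" by simp
        moreover have "\<tau> \<in> U e w \<inter> U e' w \<inter> {0<..}" using that(3-5) by simp
        ultimately show False by simp
      qed
    qed (rule s(1))
    let ?A = "voter V E (\<lambda>e. U e w) T t r"
    have "(\<lambda>p. X n p w) = step_count (?h n)" for n
      by (intro ext) (simp add: X_def step_count_def)
    then have J_eq: "J n x y w = pair_run E (step_count (?h n)) r (Suc n) 0 x y" for n x y
      by (simp only: J_def)
    have J_ge: "indicator ?A x * indicator ?A y \<le> liminf (\<lambda>n. J n x y w)" for x y
    proof (cases "x \<in> ?A \<and> y \<in> ?A")
      case True
      then have "at_time x T r" "at_time y T r" by (simp_all add: voter_def s_def[symmetric])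
      from eventually_pair_run_ge_1[OF s(2) this]
      have "\<forall>\<^sub>F n in sequentially. 1 \<le> J n x y w" by (simp only: J_eq s(3))
      then have "1 \<le> liminf (\<lambda>n. J n x y w)" by (rule Liminf_bounded)
      then show ?thesis using True by simp
    next
      case False
      then show ?thesis by (auto simp: indicator_def)
    qed
    have "(emeasure (count_space UNIV) ?A)\<^sup>2 =
        (\<integral>\<^sup>+x. indicator ?A x \<partial>count_space UNIV) * (\<integral>\<^sup>+y. indicator ?A y \<partial>count_space UNIV)"
      by (simp add: power2_eq_square)
    also have "\<dots> = (\<integral>\<^sup>+x. \<integral>\<^sup>+y. indicator ?A x * indicator ?A y \<partial>count_space UNIV \<partial>count_space UNIV)"
      by (simp add: nn_integral_cmult nn_integral_multc)
    also have "\<dots> \<le> (\<integral>\<^sup>+x. \<integral>\<^sup>+y. liminf (\<lambda>n. J n x y w) \<partial>count_space UNIV \<partial>count_space UNIV)"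
      by (intro nn_integral_mono J_ge)
    \<comment> \<open>Fatou's lemma is applied three times: to the sums over \<open>y\<close> and
      \<open>x\<close>, then to the integral over the clocks.\<close>
    also have "\<dots> \<le> (\<integral>\<^sup>+x. liminf (\<lambda>n. \<integral>\<^sup>+y. J n x y w \<partial>count_space UNIV) \<partial>count_space UNIV)"
      by (intro nn_integral_mono nn_integral_liminf) simp
    also have "\<dots> \<le> liminf (\<lambda>n. ?S n w)" by (intro nn_integral_liminf) simp
    finally show "(emeasure (count_space UNIV) ?A)\<^sup>2 \<le> liminf (\<lambda>n. ?S n w)" .
  qed
  then have "(\<integral>\<^sup>+w. (emeasure (count_space UNIV) (voter V E (\<lambda>e. U e w) T t r))\<^sup>2 \<partial>N)
      \<le> (\<integral>\<^sup>+w. liminf (\<lambda>n. ?S n w) \<partial>N)" by (rule nn_integral_mono_AE)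
  also have "\<dots> \<le> liminf (\<lambda>n. \<integral>\<^sup>+w. ?S n w \<partial>N)" by (rule nn_integral_liminf[OF S_meas])
  finally show ?thesis by (simp only: S_int)
qed

text \<open>A last use of Fatou's lemma, now over the graph, where \<open>total_prob\<close> is
  measurable by locality. Infinite expected degree is included, since \<open>ennreal\<close> has
  \<open>0 * \<top> = 0\<close>.\<close>

theorem proposition2:
  fixes M :: "'a measure" and V :: "'a \<Rightarrow> nat set" and E :: "'a \<Rightarrow> (nat \<times> nat) set"
    and \<rho> :: "'a \<Rightarrow> nat"
    and N :: "'a \<Rightarrow> 'w measure" and U :: "'a \<Rightarrow> nat \<times> nat \<Rightarrow> 'w \<Rightarrow> real set"
    and t T :: real
  assumes "random_rooted_graph M V E \<rho>"
    and "unimodular M V E \<rho>"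
    and "\<And>\<omega>. \<omega> \<in> space M \<Longrightarrow> poisson_clocks (E \<omega>) (N \<omega>) (U \<omega>)"
    and "AE \<omega> in M. AE w in N \<omega>. nonexplosive (E \<omega>) (\<lambda>e. U \<omega> e w) (\<rho> \<omega>)"
    and "0 \<le> t" and "t \<le> T"
  shows "annealed_expectation M N
           (\<lambda>\<omega> w. (emeasure (count_space UNIV) (voter (V \<omega>) (E \<omega>) (\<lambda>e. U \<omega> e w) T t (\<rho> \<omega>)))\<^sup>2)
         \<le> 1 + 2 * ennreal t * (\<integral>\<^sup>+\<omega>. of_nat (card (E \<omega> `` {\<rho> \<omega>})) \<partial>M)"
proof -
  let ?h = "\<lambda>n. t / real (Suc n)"
  let ?d = "\<lambda>\<omega>. of_nat (card (E \<omega> `` {\<rho> \<omega>})) :: ennreal"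
  have h: "0 \<le> ?h n" for n using assms(5) by simp
  have "annealed_expectation M N
           (\<lambda>\<omega> w. (emeasure (count_space UNIV) (voter (V \<omega>) (E \<omega>) (\<lambda>e. U \<omega> e w) T t (\<rho> \<omega>)))\<^sup>2)
      \<le> (\<integral>\<^sup>+\<omega>. liminf (\<lambda>n. total_prob (?h n) (Suc n) (E \<omega>) (\<rho> \<omega>)) \<partial>M)"
    unfolding annealed_expectation_def
    by (intro nn_integral_mono voter_second_moment_le random_rooted_graphD(1)[OF assms(1)] assms)
  also have "\<dots> \<le> liminf (\<lambda>n. \<integral>\<^sup>+\<omega>. total_prob (?h n) (Suc n) (E \<omega>) (\<rho> \<omega>) \<partial>M)"
    by (rule nn_integral_liminf[OF total_prob_measurable[OF assms(1) h]])
  also have "\<dots> \<le> liminf (\<lambda>n::nat. 1 + 2 * ennreal t * (\<integral>\<^sup>+\<omega>. ?d \<omega> \<partial>M))"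
  proof (intro Liminf_mono always_eventually allI)
    fix n
    have deg: "?d \<in> borel_measurable M"
    proof -
      have "local_fun 1 (\<lambda>E rs. of_nat (card (out_edges E (set rs))) :: ennreal)"
        by (rule local_fun_comp[OF local_fun_card_out_edges])
      from random_rooted_graph_measurable[OF assms(1) this] show ?thesis
        by (simp add: card_out_edges_singleton)
    qed
    have "real (Suc n) * ?h n = t" by simp
    \<comment> \<open>The \<open>Suc n\<close> steps of length \<open>?h n\<close> add up to
      \<open>t\<close>, so the discrete bound does not depend on \<open>n\<close>.\<close>
    then have th: "of_nat (Suc n) * ennreal (?h n) = ennreal t"
      using h[of n] by (metis ennreal_mult ennreal_of_nat_eq_real_of_nat of_nat_0_le_iff)
    have "(\<integral>\<^sup>+\<omega>. total_prob (?h n) (Suc n) (E \<omega>) (\<rho> \<omega>) \<partial>M)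
        \<le> 1 + of_nat (Suc n) * (\<integral>\<^sup>+\<omega>. merge_rate (?h n) (E \<omega>) (\<rho> \<omega>) \<partial>M)"
      by (rule nn_integral_total_prob_le[OF assms(1,2) h])
    also have "(\<integral>\<^sup>+\<omega>. merge_rate (?h n) (E \<omega>) (\<rho> \<omega>) \<partial>M) = 2 * ennreal (?h n) * (\<integral>\<^sup>+\<omega>. ?d \<omega> \<partial>M)"
      unfolding merge_rate_def using deg by (rule nn_integral_cmult)
    also have "of_nat (Suc n) * (2 * ennreal (?h n) * (\<integral>\<^sup>+\<omega>. ?d \<omega> \<partial>M)) =
        2 * (of_nat (Suc n) * ennreal (?h n)) * (\<integral>\<^sup>+\<omega>. ?d \<omega> \<partial>M)"
      by (simp only: mult_ac)
    finally show "(\<integral>\<^sup>+\<omega>. total_prob (?h n) (Suc n) (E \<omega>) (\<rho> \<omega>) \<partial>M)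
        \<le> 1 + 2 * ennreal t * (\<integral>\<^sup>+\<omega>. ?d \<omega> \<partial>M)" by (simp only: th)
  qed
  also have "\<dots> = 1 + 2 * ennreal t * (\<integral>\<^sup>+\<omega>. ?d \<omega> \<partial>M)" by (rule Liminf_const) simp
  finally show ?thesis .
qed

end
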